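(* Let $f,g\in L^\infty(\mathbb{R}^n)$ with $g\ge0$, and let $\Omega\subset\mathbb{R}^n$ be an open set with $|\Omega|<\infty$. If $-\infty<\lambda<\lambda^*(\Omega)$, then $\mathcal{J}_{f,g,\lambda,\Omega}$ is coercive in $H_0^1(\Omega)$. If $\lambda>\lambda^*(\Omega)$, then $\mathcal{J}_{f,g,\lambda,\Omega}$ is unbounded from below in $\mathbb{K}(\Omega)$.
   Context: $n\ge2$. $H_0^1(\Omega)$ is the closure of $C_c^\infty(\Omega)$ in $H^1(\Omega)$ and $\mathbb{K}(\Omega)=\{u\in H_0^1(\Omega):u\ge0\text{ a.e.}\}$. The functional is $$\mathcal{J}_{f,g,\lambda,\Omega}(u)=\int_\Omega\big(|\nabla u|^2-\lambda|u|^2-2fu+g^2\chi_{\{u>0\}}\big)\,dx,\qquad u\in H_0^1(\Omega),$$ where $\chi_{\{u>0\}}(x)=1$ if $u(x)>0$ and $0$ otherwise (a.e. sense). The fundamental tone is $\lambda^*(\Omega)=\inf\{\|\nabla\phi\|_{L^2(\Omega)}^2/\|\phi\|_{L^2(\Omega)}^2:\phi\in C_c^\infty(\Omega),\phi\not\equiv0\}$. Coercive means that there are constants $c>0$, $C\ge 0$ with $\mathcal{J}_{f,g,\lambda,\Omega}(u)\ge c\|u\|_{H^1(\Omega)}^2-C$ for all $u\in H_0^1(\Omega)$. *)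

theory Defs
  imports "HOL-Analysis.Analysis"
begin

section \<open>Classical derivatives and test functions\<close>

definition partial_deriv :: "'n::finite \<Rightarrow> (real^'n \<Rightarrow> real) \<Rightarrow> real^'n \<Rightarrow> real" where
  "partial_deriv i \<phi> x = frechet_derivative \<phi> (at x) (axis i 1)"

definition grad :: "(real^'n::finite \<Rightarrow> real) \<Rightarrow> real^'n \<Rightarrow> real^'n" where
  "grad \<phi> x = (\<chi> i. partial_deriv i \<phi> x)"

primrec C_diff :: "nat \<Rightarrow> (real^'n::finite \<Rightarrow> real) \<Rightarrow> bool" where
  "C_diff 0 \<phi> \<longleftrightarrow> continuous_on UNIV \<phi>"
| "C_diff (Suc k) \<phi> \<longleftrightarrow> (\<forall>x. \<phi> differentiable (at x)) \<and> (\<forall>i. C_diff k (partial_deriv i \<phi>))"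

text \<open>Elements of \<open>C\<^sub>c\<^sup>\<infinity>(\<Omega>)\<close> are represented by their extension by zero to the whole space.\<close>

definition test_fun :: "(real^'n::finite) set \<Rightarrow> (real^'n \<Rightarrow> real) set" where
  "test_fun \<Omega> = {\<phi>. (\<forall>k. C_diff k \<phi>) \<and> compact (closure {x. \<phi> x \<noteq> 0}) \<and> closure {x. \<phi> x \<noteq> 0} \<subseteq> \<Omega>}"

section \<open>Lebesgue and Sobolev spaces\<close>

text \<open>Elements of the function spaces are represented by functions rather than by classes modulo
  a.e. equality; the values outside \<open>\<Omega>\<close> of a function in a space over \<open>\<Omega>\<close> are irrelevant.\<close>

definition Linf :: "(real^'n::finite \<Rightarrow> real) set" where
  "Linf = {f. f \<in> borel_measurable lebesgue \<and> (\<exists>B. AE x in lebesgue. \<bar>f x\<bar> \<le> B)}"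

definition L2 :: "(real^'n::finite) set \<Rightarrow> (real^'n \<Rightarrow> 'b::euclidean_space) set" where
  "L2 \<Omega> = {u. u \<in> borel_measurable (lebesgue_on \<Omega>) \<and> integrable (lebesgue_on \<Omega>) (\<lambda>x. (norm (u x))\<^sup>2)}"

definition L2_norm :: "(real^'n::finite) set \<Rightarrow> (real^'n \<Rightarrow> 'b::euclidean_space) \<Rightarrow> real" where
  "L2_norm \<Omega> u = sqrt (\<integral>x. (norm (u x))\<^sup>2 \<partial>lebesgue_on \<Omega>)"

definition L1_loc :: "(real^'n::finite) set \<Rightarrow> (real^'n \<Rightarrow> 'b::euclidean_space) set" where
  "L1_loc \<Omega> = {u. \<forall>K. compact K \<and> K \<subseteq> \<Omega> \<longrightarrow> set_integrable lebesgue K u}"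

definition has_weak_grad ::
    "(real^'n::finite) set \<Rightarrow> (real^'n \<Rightarrow> real) \<Rightarrow> (real^'n \<Rightarrow> real^'n) \<Rightarrow> bool" where
  "has_weak_grad \<Omega> u G \<longleftrightarrow> u \<in> L1_loc \<Omega> \<and> G \<in> L1_loc \<Omega> \<and>
     (\<forall>\<phi>\<in>test_fun \<Omega>. \<forall>i.
        (\<integral>x. u x * partial_deriv i \<phi> x \<partial>lebesgue_on \<Omega>) = - (\<integral>x. G x $ i * \<phi> x \<partial>lebesgue_on \<Omega>))"

text \<open>For open \<open>\<Omega>\<close> a weak gradient is determined up to a null subset of \<open>\<Omega>\<close>, so the integrals
  below do not depend on the representative that is chosen here.\<close>

definition weak_grad :: "(real^'n::finite) set \<Rightarrow> (real^'n \<Rightarrow> real) \<Rightarrow> real^'n \<Rightarrow> real^'n" where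
  "weak_grad \<Omega> u = (SOME G. has_weak_grad \<Omega> u G)"

definition H1 :: "(real^'n::finite) set \<Rightarrow> (real^'n \<Rightarrow> real) set" where
  "H1 \<Omega> = {u. u \<in> L2 \<Omega> \<and> (\<exists>G. has_weak_grad \<Omega> u G \<and> G \<in> L2 \<Omega>)}"

definition H1_norm :: "(real^'n::finite) set \<Rightarrow> (real^'n \<Rightarrow> real) \<Rightarrow> real" where
  "H1_norm \<Omega> u = sqrt ((L2_norm \<Omega> u)\<^sup>2 + (L2_norm \<Omega> (weak_grad \<Omega> u))\<^sup>2)"

definition H10 :: "(real^'n::finite) set \<Rightarrow> (real^'n \<Rightarrow> real) set" where
  "H10 \<Omega> = {u \<in> H1 \<Omega>. \<forall>\<epsilon>>0. \<exists>\<phi>\<in>test_fun \<Omega>. H1_norm \<Omega> (\<lambda>x. u x - \<phi> x) < \<epsilon>}"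

definition K_cone :: "(real^'n::finite) set \<Rightarrow> (real^'n \<Rightarrow> real) set" where
  "K_cone \<Omega> = {u \<in> H10 \<Omega>. AE x in lebesgue_on \<Omega>. 0 \<le> u x}"

section \<open>The functional and the fundamental tone\<close>

definition J_fun :: "(real^'n::finite \<Rightarrow> real) \<Rightarrow> (real^'n \<Rightarrow> real) \<Rightarrow> real \<Rightarrow> (real^'n) set
    \<Rightarrow> (real^'n \<Rightarrow> real) \<Rightarrow> real" where
  "J_fun f g lam \<Omega> u =
     (\<integral>x. (norm (weak_grad \<Omega> u x))\<^sup>2 - lam * \<bar>u x\<bar>\<^sup>2 - 2 * f x * u x
            + (g x)\<^sup>2 * indicator {y. 0 < u y} x \<partial>lebesgue_on \<Omega>)"

text \<open>Taken in the extended reals, so that the infimum is \<open>\<infinity>\<close> for \<open>\<Omega> = {}\<close>, where there is no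
  nonzero test function.\<close>

definition fundamental_tone :: "(real^'n::finite) set \<Rightarrow> ereal" where
  "fundamental_tone \<Omega> =
     (INF \<phi>\<in>{\<phi> \<in> test_fun \<Omega>. \<exists>x. \<phi> x \<noteq> 0}. ereal ((L2_norm \<Omega> (grad \<phi>))\<^sup>2 / (L2_norm \<Omega> \<phi>)\<^sup>2))"

definition coercive_on_H10 :: "(real^'n::finite) set \<Rightarrow> ((real^'n \<Rightarrow> real) \<Rightarrow> real) \<Rightarrow> bool" where
  "coercive_on_H10 \<Omega> J \<longleftrightarrow>
     (\<exists>c>0. \<exists>C\<ge>0. \<forall>u\<in>H10 \<Omega>. J u \<ge> c * (H1_norm \<Omega> u)\<^sup>2 - C)"

definition unbounded_below_on :: "'a set \<Rightarrow> ('a \<Rightarrow> real) \<Rightarrow> bool" where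
  "unbounded_below_on A J \<longleftrightarrow> (\<forall>M. \<exists>u\<in>A. J u < M)"

end

theory Submission
  imports Defs
begin

text \<open>The lower-order part of the functional, the integral of \<open>- 2 f u + g\<^sup>2 \<chi>\<close>, is at most
  \<open>\<delta> \<parallel>u\<parallel>\<^sup>2 + C\<^sub>\<delta>\<close> in absolute value for every \<open>\<delta> > 0\<close>, because \<open>f\<close> and \<open>g\<close> are bounded and
  \<open>\<Omega>\<close> has finite measure (\<open>J_fun_estimate\<close>). Hence only the sign of the quadratic form
  \<open>\<parallel>\<nabla>u\<parallel>\<^sup>2 - \<lambda> \<parallel>u\<parallel>\<^sup>2\<close> matters, and that sign is what the fundamental tone measures.

  If \<open>\<lambda>\<close> lies below the tone, choose \<open>\<Lambda>\<close> strictly between them. The inequality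
  \<open>\<Lambda> \<parallel>\<phi>\<parallel>\<^sup>2 \<le> \<parallel>\<nabla>\<phi>\<parallel>\<^sup>2\<close> for test functions passes to the closure \<open>H10 \<Omega>\<close>
  (\<open>gradient_lower_bound_H10\<close>), and the gap \<open>\<Lambda> - \<lambda>\<close> pays both for \<open>\<delta>\<close> and for a small multiple of the
  full Sobolev norm.

  If \<open>\<lambda>\<close> lies above the tone, some test function \<open>\<phi>\<close> makes the quadratic form negative. Multiples of
  \<open>\<bar>\<phi>\<bar>\<close> would drive the functional to \<open>-\<infinity>\<close>; to stay inside the smooth functions, \<open>\<bar>\<phi>\<bar>\<close> is replaced by
  \<open>sqrt (\<phi>\<^sup>2 + e\<^sup>2) - e\<close>, which is again a nonnegative test function, has no larger gradient, and has
  almost the same \<open>L\<^sup>2\<close> norm when \<open>e\<close> is small (\<open>scaled_smooth_abs_test_fun\<close>). No weak derivative of an absolute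
  value is ever computed.

  Both halves rest on the fact that \<open>weak_grad\<close>, an arbitrary choice, has the expected \<open>L\<^sup>2\<close> norm: weak
  gradients are unique almost everywhere (\<open>has_weak_grad_unique\<close>, from the fundamental lemma of the
  calculus of variations \<open>AE_eq_0_if_orthogonal_to_test_funs\<close>), and the classical gradient of a test
  function is one of them (\<open>has_weak_grad_test_fun\<close>, from integration by parts).\<close>

section \<open>Calculus of smooth functions\<close>

lemma partial_deriv_eq:
  assumes "(\<phi> has_derivative D) (at x)"
  shows "partial_deriv i \<phi> x = D (axis i 1)"
  using frechet_derivative_at[OF assms] by (simp add: partial_deriv_def)

lemma C_diff_SucD: "C_diff (Suc k) \<phi> \<Longrightarrow> C_diff k \<phi>"
proof (induction k arbitrary: \<phi>)
  case 0
  then show ?case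
    by (auto simp: continuous_on_eq_continuous_at differentiable_imp_continuous_within)
next
  case (Suc k)
  then show ?case by auto
qed

lemma C_diff_const: "C_diff k (\<lambda>x. c)"
proof (induction k arbitrary: c)
  case (Suc k)
  have "partial_deriv i (\<lambda>x. c) = (\<lambda>x. 0)" for i :: 'a
    by (rule ext) (rule partial_deriv_eq[OF has_derivative_const])
  then show ?case using Suc[of 0] by simp
qed simp

lemma partial_deriv_add:
  assumes "\<phi> differentiable (at x)" "\<psi> differentiable (at x)"
  shows "partial_deriv i (\<lambda>x. \<phi> x + \<psi> x) x = partial_deriv i \<phi> x + partial_deriv i \<psi> x"
  using partial_deriv_eq[OF has_derivative_add[OF assms[unfolded frechet_derivative_works]], of i]
  by (simp add: partial_deriv_def)

lemma C_diff_add: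
  assumes "C_diff k \<phi>" "C_diff k \<psi>"
  shows "C_diff k (\<lambda>x. \<phi> x + \<psi> x)"
  using assms
proof (induction k arbitrary: \<phi> \<psi>)
  case 0
  then show ?case by (simp add: continuous_on_add)
next
  case (Suc k)
  have "partial_deriv i (\<lambda>x. \<phi> x + \<psi> x) = (\<lambda>x. partial_deriv i \<phi> x + partial_deriv i \<psi> x)" for i
    using Suc.prems by (intro ext partial_deriv_add) auto
  then show ?case using Suc by simp
qed

lemma partial_deriv_mult:
  assumes "\<phi> differentiable (at x)" "\<psi> differentiable (at x)"
  shows "partial_deriv i (\<lambda>x. \<phi> x * \<psi> x) x
           = \<phi> x * partial_deriv i \<psi> x + partial_deriv i \<phi> x * \<psi> x"
  using partial_deriv_eq[OF has_derivative_mult[OF assms[unfolded frechet_derivative_works]], of i]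
  by (simp add: partial_deriv_def)

lemma C_diff_mult:
  assumes "C_diff k \<phi>" "C_diff k \<psi>"
  shows "C_diff k (\<lambda>x. \<phi> x * \<psi> x)"
  using assms
proof (induction k arbitrary: \<phi> \<psi>)
  case 0
  then show ?case by (simp add: continuous_on_mult)
next
  case (Suc k)
  have "partial_deriv i (\<lambda>x. \<phi> x * \<psi> x)
          = (\<lambda>x. \<phi> x * partial_deriv i \<psi> x + partial_deriv i \<phi> x * \<psi> x)" for i
    using Suc.prems by (intro ext partial_deriv_mult) auto
  moreover have "C_diff k (\<lambda>x. \<phi> x * partial_deriv i \<psi> x + partial_deriv i \<phi> x * \<psi> x)" for i
    using Suc.prems C_diff_SucD[of k \<phi>] C_diff_SucD[of k \<psi>]
    by (intro C_diff_add Suc.IH) simp_all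
  moreover have "(\<lambda>x. \<phi> x * \<psi> x) differentiable at x" for x
    using Suc.prems by (simp add: differentiable_mult)
  ultimately show ?case by simp
qed

lemma C_diff_prod:
  assumes "finite I" "\<And>j. j \<in> I \<Longrightarrow> C_diff k (\<phi> j)"
  shows "C_diff k (\<lambda>x. \<Prod>j\<in>I. \<phi> j x)"
  using assms
proof (induction I rule: finite_induct)
  case empty
  show ?case using C_diff_const[of k 1] by simp
next
  case (insert j I)
  then have "C_diff k (\<lambda>x. \<phi> j x * (\<Prod>j\<in>I. \<phi> j x))"
    by (intro C_diff_mult) auto
  then show ?case by (simp only: prod.insert[OF insert.hyps])
qed

lemma C_diff_affine: "C_diff k (\<lambda>x::real^'n::finite. c * (x $ j) + d)"
proof (cases k)
  case 0
  then show ?thesis by (simp add: continuous_on_add continuous_on_mult continuous_on_component)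
next
  case (Suc m)
  have D: "((\<lambda>x::real^'n. c * (x $ j) + d) has_derivative (\<lambda>h. c * (h $ j))) (at x)" for x
    by (auto intro!: derivative_eq_intros bounded_linear_imp_has_derivative bounded_linear_vec_nth)
  have "partial_deriv i (\<lambda>x::real^'n. c * (x $ j) + d) = (\<lambda>x. c * (axis i 1 $ j))" for i
    by (intro ext partial_deriv_eq[OF D])
  then show ?thesis using Suc D by (auto simp: differentiable_def intro: C_diff_const)
qed

text \<open>A set of functions that contains a derivative of each of its members consists of smooth functions.
  Exhibiting such a set replaces formulas for the higher derivatives.\<close>

definition smooth_family :: "(real \<Rightarrow> real) set \<Rightarrow> bool" where
  "smooth_family S \<longleftrightarrow> (\<forall>h\<in>S. \<exists>h'\<in>S. \<forall>y. (h has_real_derivative h' y) (at y))"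

lemma partial_deriv_compose:
  assumes "(h has_real_derivative h') (at (\<phi> x))" "\<phi> differentiable (at x)"
  shows "(\<lambda>x. h (\<phi> x)) differentiable (at x)"
    and "partial_deriv i (\<lambda>x. h (\<phi> x)) x = h' * partial_deriv i \<phi> x"
proof -
  have D: "((\<lambda>x. h (\<phi> x)) has_derivative (\<lambda>v. h' * frechet_derivative \<phi> (at x) v)) (at x)"
    using has_derivative_compose[of \<phi> "frechet_derivative \<phi> (at x)" x UNIV h "(*) h'"] assms
    by (simp add: has_field_derivative_def frechet_derivative_works)
  show "(\<lambda>x. h (\<phi> x)) differentiable (at x)" using D by (auto simp: differentiable_def)
  show "partial_deriv i (\<lambda>x. h (\<phi> x)) x = h' * partial_deriv i \<phi> x"
    using partial_deriv_eq[OF D] by (simp add: partial_deriv_def)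
qed

lemma C_diff_compose:
  assumes S: "smooth_family S" and "h \<in> S" "C_diff k \<phi>"
  shows "C_diff k (\<lambda>x. h (\<phi> x))"
  using assms(2,3)
proof (induction k arbitrary: h)
  case 0
  obtain h' where "\<And>y. (h has_real_derivative h' y) (at y)"
    using S 0 unfolding smooth_family_def by blast
  then have "continuous_on UNIV h"
    by (meson DERIV_isCont continuous_at_imp_continuous_on)
  with 0 show ?case using continuous_on_compose2[of UNIV h UNIV \<phi>] by simp
next
  case (Suc k)
  obtain h' where h': "h' \<in> S" "\<And>y. (h has_real_derivative h' y) (at y)"
    using S Suc.prems(1) unfolding smooth_family_def by blast
  note chain = partial_deriv_compose[where \<phi> = \<phi>, OF h'(2)]
  have diff: "\<phi> differentiable at x" for x
    using Suc.prems by simp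
  have "partial_deriv i (\<lambda>x. h (\<phi> x)) = (\<lambda>x. h' (\<phi> x) * partial_deriv i \<phi> x)" for i
    by (rule ext) (rule chain(2)[OF diff])
  moreover have "(\<lambda>x. h (\<phi> x)) differentiable at x" for x
    by (rule chain(1)[OF diff])
  moreover have "C_diff k (\<lambda>x. h' (\<phi> x) * partial_deriv i \<phi> x)" for i
    using Suc.prems(2) by (intro C_diff_mult[OF Suc.IH[OF h'(1) C_diff_SucD]]) simp_all
  ultimately show ?case by simp
qed

text \<open>For \<open>p = 1\<close> this is the classical smooth function that is flat at \<open>0\<close>. The polynomial
  factor makes the family closed under differentiation.\<close>

definition flat_exp :: "real poly \<Rightarrow> real \<Rightarrow> real" where
  "flat_exp p t = (if t > 0 then poly p (1 / t) * exp (- (1 / t)) else 0)"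

lemma tendsto_poly_times_exp_0: "((\<lambda>s. poly p s * exp (- s)) \<longlongrightarrow> (0::real)) at_top"
proof -
  have "((\<lambda>s. s ^ k * exp (- s)) \<longlongrightarrow> (0::real)) at_top" for k
    using tendsto_power_div_exp_0[of k] by (simp add: exp_minus divide_inverse)
  then have "((\<lambda>s. coeff p k * (s ^ k * exp (- s))) \<longlongrightarrow> coeff p k * 0) at_top" for k
    by (rule tendsto_mult_left)
  then have "((\<lambda>s. \<Sum>i\<le>degree p. coeff p i * (s ^ i * exp (- s)))
               \<longlongrightarrow> (\<Sum>i\<le>degree p. coeff p i * 0)) at_top"
    by (rule tendsto_sum)
  then show ?thesis by (simp add: poly_altdef sum_distrib_right mult.assoc)
qed

text \<open>Away from \<open>0\<close> this is the product and chain rule in the variable \<open>1 / t\<close>, where differentiating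
  \<open>1 / t\<close> contributes the factor \<open>(1 / t)\<^sup>2\<close>. At \<open>0\<close> the difference quotient vanishes in the limit
  since the exponential beats every polynomial in \<open>1 / t\<close>.\<close>

lemma flat_exp_deriv:
  "(flat_exp p has_real_derivative flat_exp ((p - pderiv p) * [:0, 0, 1:]) t) (at t)"
proof -
  consider "t > 0" | "t < 0" | "t = 0" by linarith
  then show ?thesis
  proof cases
    case 1
    have "((\<lambda>t. poly p (1 / t) * exp (- (1 / t))) has_real_derivative
        flat_exp ((p - pderiv p) * [:0, 0, 1:]) t) (at t)"
      using 1 by (auto intro!: derivative_eq_intros DERIV_chain'[OF _ poly_DERIV]
          simp: flat_exp_def field_simps power2_eq_square)
    then show ?thesis
      by (rule DERIV_cong_ev[THEN iffD1, rotated -1])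
        (use 1 in \<open>auto simp: flat_exp_def eventually_nhds intro!: exI[of _ "{0<..}"]\<close>)
  next
    case 2
    have "((\<lambda>t. 0) has_real_derivative flat_exp ((p - pderiv p) * [:0, 0, 1:]) t) (at t)"
      using 2 by (simp add: flat_exp_def)
    then show ?thesis
      by (rule DERIV_cong_ev[THEN iffD1, rotated -1])
        (use 2 in \<open>auto simp: flat_exp_def eventually_nhds intro!: exI[of _ "{..<0}"]\<close>)
  next
    case 3
    have "((\<lambda>h. poly (p * [:0, 1:]) (inverse h) * exp (- inverse h)) \<longlongrightarrow> 0) (at_right 0)"
      using filterlim_compose[OF tendsto_poly_times_exp_0 filterlim_inverse_at_top_right] .
    then have "((\<lambda>h. flat_exp p h / h) \<longlongrightarrow> 0) (at_right 0)"
      by (rule Lim_transform_eventually)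
        (auto simp: flat_exp_def eventually_at_filter inverse_eq_divide)
    moreover have "((\<lambda>h. flat_exp p h / h) \<longlongrightarrow> 0) (at_left 0)"
      by (rule Lim_transform_eventually[OF tendsto_const])
        (auto simp: flat_exp_def eventually_at_filter)
    ultimately have "((\<lambda>h. flat_exp p h / h) \<longlongrightarrow> 0) (at 0)"
      by (simp add: filterlim_at_split)
    then show ?thesis
      using 3 by (simp add: DERIV_def flat_exp_def)
  qed
qed

lemma smooth_family_flat_exp: "smooth_family (range flat_exp)"
  unfolding smooth_family_def using flat_exp_deriv by blast

text \<open>The additive constant \<open>c\<close> puts \<open>sqrt (y\<^sup>2 + e\<^sup>2) - e\<close> itself into the family.\<close>

lemma smooth_family_poly_powr:
  assumes "e > 0"
  shows "smooth_family {h. \<exists>p a c. h = (\<lambda>y. poly p y * (y\<^sup>2 + e\<^sup>2) powr a + c)}"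
    (is "smooth_family ?S")
  unfolding smooth_family_def
proof
  fix h assume "h \<in> ?S"
  then obtain p a c where h: "h = (\<lambda>y. poly p y * (y\<^sup>2 + e\<^sup>2) powr a + c)" by blast
  let ?q = "pderiv p * [:e\<^sup>2, 0, 1:] + smult (2 * a) (p * [:0, 1:])"
  have D': "(h has_real_derivative poly ?q y * (y\<^sup>2 + e\<^sup>2) powr (a - 1) + 0) (at y)" for y
  proof -
    have pos: "y\<^sup>2 + e\<^sup>2 > 0" using assms by (simp add: add_nonneg_pos)
    have pow: "(y\<^sup>2 + e\<^sup>2) powr a = (y\<^sup>2 + e\<^sup>2) powr (a - 1) * (y\<^sup>2 + e\<^sup>2)"
      using pos powr_add[of "y\<^sup>2 + e\<^sup>2" "a - 1" 1] by simp
    have D: "((\<lambda>y. (y\<^sup>2 + e\<^sup>2) powr a) has_real_derivative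
        a * (y\<^sup>2 + e\<^sup>2) powr (a - 1) * (2 * y)) (at y)"
      by (rule DERIV_fun_powr[THEN DERIV_cong])
        (use pos in \<open>auto intro!: derivative_eq_intros\<close>)
    show ?thesis
      unfolding h
      by (rule DERIV_cong[OF DERIV_add[OF DERIV_mult[OF poly_DERIV D] DERIV_const]])
        (simp add: pow, simp add: algebra_simps power2_eq_square)
  qed
  have "(\<lambda>y. poly ?q y * (y\<^sup>2 + e\<^sup>2) powr (a - 1) + 0) \<in> ?S" by blast
  then show "\<exists>h'\<in>?S. \<forall>y. (h has_real_derivative h' y) (at y)"
    using D' by (intro bexI[rotated] allI)
qed

section \<open>Test functions and integration by parts\<close>

lemma test_funD:
  assumes "\<phi> \<in> test_fun \<Omega>"
  shows "C_diff k \<phi>" "\<phi> differentiable (at x)" "continuous_on UNIV \<phi>"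
    and "continuous_on UNIV (partial_deriv i \<phi>)"
    and "compact (closure {x. \<phi> x \<noteq> 0})" "closure {x. \<phi> x \<noteq> 0} \<subseteq> \<Omega>"
proof -
  have C: "C_diff k \<phi>" for k using assms by (simp add: test_fun_def)
  show "C_diff k \<phi>" by (rule C)
  show "continuous_on UNIV \<phi>" using C[of 0] by simp
  show "\<phi> differentiable (at x)" "continuous_on UNIV (partial_deriv i \<phi>)"
    using C[of "Suc 0"] by simp_all
  show "compact (closure {x. \<phi> x \<noteq> 0})" "closure {x. \<phi> x \<noteq> 0} \<subseteq> \<Omega>"
    using assms by (simp_all add: test_fun_def)
qed

lemma zero_outside_support: "x \<notin> closure {x. \<phi> x \<noteq> 0} \<Longrightarrow> \<phi> x = 0"
  using closure_subset[of "{x. \<phi> x \<noteq> 0}"] by auto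

lemma partial_deriv_outside_support:
  assumes "x \<notin> closure {x. \<phi> x \<noteq> 0}"
  shows "partial_deriv i \<phi> x = 0"
proof -
  have "(\<phi> has_derivative (\<lambda>_. 0)) (at x)"
  proof (rule has_derivative_transform_within_open)
    show "((\<lambda>_. 0) has_derivative (\<lambda>_. 0)) (at x)" by (rule has_derivative_const)
    show "open (- closure {x. \<phi> x \<noteq> 0})" by (simp add: open_Compl)
    show "x \<in> - closure {x. \<phi> x \<noteq> 0}" using assms by simp
    show "0 = \<phi> y" if "y \<in> - closure {x. \<phi> x \<noteq> 0}" for y
      using zero_outside_support[of y \<phi>] that by simp
  qed
  then show ?thesis by (rule partial_deriv_eq)
qed

lemma test_fun_support:
  assumes "\<phi> \<in> test_fun \<Omega>"
  obtains K where "compact K" "K \<subseteq> \<Omega>" "\<And>x. x \<notin> K \<Longrightarrow> \<phi> x = 0"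
    "\<And>i x. x \<notin> K \<Longrightarrow> partial_deriv i \<phi> x = 0"
  by (rule that[OF test_funD(5,6)[OF assms] zero_outside_support[where \<phi> = \<phi>]
        partial_deriv_outside_support[where \<phi> = \<phi>]])

lemma bounded_if_continuous_zero_outside_compact:
  fixes \<psi> :: "'a::topological_space \<Rightarrow> real"
  assumes "continuous_on UNIV \<psi>" "compact K" "\<And>x. x \<notin> K \<Longrightarrow> \<psi> x = 0"
  obtains B where "0 \<le> B" "\<And>x. \<bar>\<psi> x\<bar> \<le> B"
proof -
  have "bounded (\<psi> ` K)"
    by (intro compact_imp_bounded compact_continuous_image continuous_on_subset[OF assms(1)] assms(2)) simp
  then obtain B where "\<And>x. x \<in> K \<Longrightarrow> \<bar>\<psi> x\<bar> \<le> B"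
    by (auto simp: bounded_iff)
  then have "\<bar>\<psi> x\<bar> \<le> max 0 B" for x
    by (cases "x \<in> K") (simp_all add: assms(3) max.coboundedI2)
  then show ?thesis using that[of "max 0 B"] by simp
qed

lemma continuous_imp_borel_measurable_lebesgue:
  "continuous_on UNIV \<psi> \<Longrightarrow> \<psi> \<in> borel_measurable lebesgue"
  by (simp add: borel_measurable_continuous_onI measurable_completion)

lemma continuous_imp_L1_loc:
  fixes G :: "real^'n::finite \<Rightarrow> 'b::euclidean_space"
  assumes "continuous_on UNIV G"
  shows "G \<in> L1_loc \<Omega>"
  unfolding L1_loc_def
proof (intro CollectI allI impI)
  fix K assume K: "compact K \<and> K \<subseteq> \<Omega>"
  have "set_integrable lborel K G"
    using K borel_integrable_compact[of K G] continuous_on_subset[OF assms, of K]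
    by (simp add: set_integrable_def)
  moreover have "(\<lambda>x. indicat_real K x *\<^sub>R G x) \<in> borel_measurable lborel"
    using K borel_measurable_continuous_onI[OF assms]
    by (intro borel_measurable_scaleR borel_measurable_indicator) (auto simp: borel_compact)
  ultimately show "set_integrable lebesgue K G"
    by (simp add: set_integrable_def integrable_completion)
qed

lemma integral_lebesgue_on_supported:
  fixes f :: "real^'n::finite \<Rightarrow> 'b::euclidean_space"
  assumes "open \<Omega>" "\<And>x. x \<notin> \<Omega> \<Longrightarrow> f x = 0"
  shows "integral\<^sup>L (lebesgue_on \<Omega>) f = integral\<^sup>L lebesgue f"
    and "integrable (lebesgue_on \<Omega>) f \<longleftrightarrow> integrable lebesgue f"
proof -
  have [simp]: "\<Omega> \<in> sets lebesgue" using assms(1) by auto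
  have eq: "(\<lambda>x. indicator \<Omega> x *\<^sub>R f x) = f"
    using assms(2) by (auto split: split_indicator)
  show "integral\<^sup>L (lebesgue_on \<Omega>) f = integral\<^sup>L lebesgue f"
    by (subst integral_restrict_space) (simp_all add: eq)
  show "integrable (lebesgue_on \<Omega>) f \<longleftrightarrow> integrable lebesgue f"
    by (subst integrable_restrict_space) (simp_all add: eq)
qed

lemma integrable_L1_loc_mult:
  fixes u \<psi> :: "real^'n::finite \<Rightarrow> real"
  assumes \<Omega>: "open \<Omega>" and u: "u \<in> L1_loc \<Omega>" and K: "compact K" "K \<subseteq> \<Omega>"
    and cont: "continuous_on UNIV \<psi>" and zero: "\<And>x. x \<notin> K \<Longrightarrow> \<psi> x = 0"
  shows "integrable (lebesgue_on \<Omega>) (\<lambda>x. u x * \<psi> x)"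
proof -
  obtain B where B: "0 \<le> B" "\<And>x. \<bar>\<psi> x\<bar> \<le> B"
    using bounded_if_continuous_zero_outside_compact[OF cont K(1) zero] by blast
  have int: "integrable lebesgue (\<lambda>x. indicator K x * u x)"
    using u K by (simp add: L1_loc_def set_integrable_def)
  have "integrable lebesgue (\<lambda>x. (indicator K x * u x) * \<psi> x)"
  proof (rule Bochner_Integration.integrable_bound)
    show "integrable lebesgue (\<lambda>x. B * (indicator K x * u x))"
      using int by simp
    show "(\<lambda>x. (indicator K x * u x) * \<psi> x) \<in> borel_measurable lebesgue"
      using borel_measurable_integrable[OF int] continuous_imp_borel_measurable_lebesgue[OF cont]
      by (rule borel_measurable_times)
    show "AE x in lebesgue. norm (indicator K x * u x * \<psi> x) \<le> norm (B * (indicator K x * u x))"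
      using B by (auto simp: abs_mult mult.commute[of B] intro!: mult_left_mono)
  qed
  also have "(\<lambda>x. (indicator K x * u x) * \<psi> x) = (\<lambda>x. u x * \<psi> x)"
    using zero by (auto split: split_indicator)
  finally show ?thesis
    using integral_lebesgue_on_supported(2)[OF \<Omega>, of "\<lambda>x. u x * \<psi> x"] zero K by auto
qed

lemma integrable_continuous_compact_support:
  fixes \<psi> :: "real^'n::finite \<Rightarrow> real"
  assumes "continuous_on UNIV \<psi>" "compact K" "\<And>x. x \<notin> K \<Longrightarrow> \<psi> x = 0"
  shows "integrable lebesgue \<psi>"
  using integrable_L1_loc_mult[OF open_UNIV continuous_imp_L1_loc[OF continuous_on_const[of _ "1::real"]]
      assms(2) subset_UNIV assms(1,3)]
  by (simp add: lebesgue_on_UNIV_eq)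

lemma integral_translation:
  fixes F :: "real^'n::finite \<Rightarrow> real"
  assumes "continuous_on UNIV F"
  shows "(\<integral>x. F (x + v) \<partial>lebesgue) = (\<integral>x. F x \<partial>lebesgue)"
proof -
  have F: "F \<in> borel_measurable borel" using assms by (rule borel_measurable_continuous_onI)
  have Fv: "(\<lambda>x. F (x + v)) \<in> borel_measurable borel"
    by (rule borel_measurable_continuous_onI)
      (rule continuous_on_compose2[OF assms], auto intro!: continuous_on_add)
  have "(\<integral>x. F x \<partial>lborel) = (\<integral>x. F x \<partial>distr lborel borel ((+) v))"
    by (simp add: lborel_distr_plus)
  also have "\<dots> = (\<integral>x. F (v + x) \<partial>lborel)"
    using F by (intro integral_distr) auto
  finally show ?thesis using F Fv by (simp add: integral_completion add.commute)
qed

text \<open>The integral of a compactly supported function is invariant under translation, so its difference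
  quotients have integral \<open>0\<close>. By the mean value theorem they are dominated by a multiple of the
  indicator of a ball, so the same holds for their limit, the partial derivative. This avoids Fubini.\<close>

lemma integral_partial_deriv_eq_0:
  fixes F :: "real^'n::finite \<Rightarrow> real"
  assumes diff: "\<And>x. F differentiable (at x)"
    and cont: "continuous_on UNIV (partial_deriv i F)"
    and K: "compact (closure {x. F x \<noteq> 0})"
  shows "(\<integral>x. partial_deriv i F x \<partial>lebesgue) = 0"
proof -
  let ?K = "closure {x. F x \<noteq> 0}" and ?e = "axis i 1 :: real^'n"
  define h where "h n = inverse (real (Suc n))" for n
  have h: "0 < h n" "h n \<le> 1" for n
    by (auto simp: h_def field_simps)
  define Q where "Q = (\<lambda>n x. (F (x + h n *\<^sub>R ?e) - F x) / h n)"
  have Fcont: "continuous_on UNIV F"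
    using diff by (simp add: continuous_on_eq_continuous_at differentiable_imp_continuous_within)
  have Fv: "continuous_on UNIV (\<lambda>x. F (x + h n *\<^sub>R ?e))" for n
    by (rule continuous_on_compose2[OF Fcont]) (auto intro!: continuous_on_add)
  obtain B where B: "0 \<le> B" "\<And>x. \<bar>partial_deriv i F x\<bar> \<le> B"
    using bounded_if_continuous_zero_outside_compact[OF cont K partial_deriv_outside_support[where \<phi> = F]] by blast
  obtain R where R: "\<And>x. x \<in> ?K \<Longrightarrow> norm x \<le> R"
    using compact_imp_bounded[OF K] by (auto simp: bounded_iff)
  have line: "((\<lambda>t. F (x + t *\<^sub>R ?e)) has_real_derivative partial_deriv i F (x + t *\<^sub>R ?e)) (at t)" for x t
  proof -
    let ?D = "frechet_derivative F (at (x + t *\<^sub>R ?e))"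
    have D: "(F has_derivative ?D) (at (x + t *\<^sub>R ?e))"
      using diff by (simp add: frechet_derivative_works)
    have "((\<lambda>t. F (x + t *\<^sub>R ?e)) has_derivative (\<lambda>s. ?D (s *\<^sub>R ?e))) (at t)"
      by (rule has_derivative_compose[where g = F and f = "\<lambda>t. x + t *\<^sub>R ?e", OF _ D]) (auto intro!: derivative_eq_intros)
    moreover have "?D (s *\<^sub>R ?e) = s * ?D ?e" for s
      using linear_cmul[OF has_derivative_linear[OF D], of s ?e] by simp
    ultimately show ?thesis
      by (simp add: has_field_derivative_def partial_deriv_def mult.commute[of _ "?D ?e"])
  qed
  have Qint: "(\<integral>x. Q n x \<partial>lebesgue) = 0" for n
  proof -
    have int: "integrable lebesgue F"
      by (rule integrable_continuous_compact_support[OF Fcont K zero_outside_support[where \<phi> = F]])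
    have Kv: "compact ((+) (- (h n *\<^sub>R ?e)) ` ?K)"
      by (rule compact_translation[OF K])
    have "integrable lebesgue (\<lambda>x. F (x + h n *\<^sub>R ?e))"
    proof (rule integrable_continuous_compact_support[OF Fv Kv])
      fix x assume "x \<notin> (+) (- (h n *\<^sub>R ?e)) ` ?K"
      moreover have "x = - (h n *\<^sub>R ?e) + (x + h n *\<^sub>R ?e)" by simp
      ultimately have "x + h n *\<^sub>R ?e \<notin> ?K" by blast
      then show "F (x + h n *\<^sub>R ?e) = 0" by (rule zero_outside_support[where \<phi> = F])
    qed
    with int show ?thesis
      by (simp add: Q_def integral_translation[OF Fcont])
  qed
  \<comment> \<open>the radius \<open>R + 1\<close> covers the support of \<open>F\<close> shifted by at most \<open>h n \<le> 1\<close>\<close>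
  have "(\<lambda>n. \<integral>x. Q n x \<partial>lebesgue) \<longlonglongrightarrow> (\<integral>x. partial_deriv i F x \<partial>lebesgue)"
  proof (rule integral_dominated_convergence)
    show "partial_deriv i F \<in> borel_measurable lebesgue"
      using cont by (rule continuous_imp_borel_measurable_lebesgue)
    show "Q n \<in> borel_measurable lebesgue" for n
      unfolding Q_def
      by (intro continuous_imp_borel_measurable_lebesgue continuous_on_divide continuous_on_diff
            Fv Fcont continuous_on_const) (use h(1)[of n] in simp)
    show "integrable lebesgue (\<lambda>x. B * indicator (cball 0 (R + 1)) x :: real)"
      using lmeasurable_cball[of 0 "R + 1"]
      by (intro integrable_mult_right integrable_real_indicator) (auto simp: fmeasurable_def)
    have "(\<lambda>n. Q n x) \<longlonglongrightarrow> partial_deriv i F x" for x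
    proof -
      have "((\<lambda>t. (F (x + t *\<^sub>R ?e) - F x) / t) \<longlongrightarrow> partial_deriv i F x) (at 0)"
        using line[of x 0] by (simp add: DERIV_def)
      moreover have "filterlim h (at 0) sequentially"
        unfolding filterlim_at h_def
        using LIMSEQ_inverse_real_of_nat by (auto simp: h_def)
      ultimately show ?thesis
        unfolding Q_def by (rule filterlim_compose)
    qed
    then show "AE x in lebesgue. (\<lambda>n. Q n x) \<longlonglongrightarrow> partial_deriv i F x" by simp
    have "norm (Q n x) \<le> B * indicator (cball 0 (R + 1)) x" for n x
    proof (cases "x \<in> cball 0 (R + 1)")
      case True
      obtain z where "F (x + h n *\<^sub>R ?e) - F (x + 0 *\<^sub>R ?e) = (h n - 0) * partial_deriv i F (x + z *\<^sub>R ?e)"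
        using MVT2[of 0 "h n" "\<lambda>t. F (x + t *\<^sub>R ?e)" "\<lambda>t. partial_deriv i F (x + t *\<^sub>R ?e)"]
          line h(1)[of n] by blast
      then have "Q n x = partial_deriv i F (x + z *\<^sub>R ?e)"
        using h(1)[of n] by (simp add: Q_def)
      then show ?thesis using B True by simp
    next
      case False
      have "norm (x + h n *\<^sub>R ?e) \<ge> norm x - norm (h n *\<^sub>R ?e)"
        by (rule norm_diff_ineq)
      moreover have "norm (h n *\<^sub>R ?e) \<le> 1"
        using h[of n] by (simp add: norm_axis_1)
      ultimately have "norm (x + h n *\<^sub>R ?e) > R" "norm x > R"
        using False by (auto simp: not_le)
      then have "x + h n *\<^sub>R ?e \<notin> ?K" "x \<notin> ?K" using R by (auto simp: not_le[symmetric])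
      from this[THEN zero_outside_support[where \<phi> = F]] show ?thesis
        using False by (simp add: Q_def)
    qed
    then show "AE x in lebesgue. norm (Q n x) \<le> B * indicator (cball 0 (R + 1)) x" for n by simp
  qed
  then show ?thesis by (simp add: Qint LIMSEQ_const_iff)
qed


lemma continuous_grad: "\<phi> \<in> test_fun \<Omega> \<Longrightarrow> continuous_on UNIV (grad \<phi>)"
  unfolding grad_def by (intro continuous_on_vec_lambda) (rule test_funD(4))

text \<open>Integration by parts: the integral of a partial derivative vanishes, applied to the product of
  \<open>\<phi>\<close> with the test function it is paired with.\<close>

lemma has_weak_grad_test_fun:
  assumes \<Omega>: "open \<Omega>" and \<phi>: "\<phi> \<in> test_fun \<Omega>"
  shows "has_weak_grad \<Omega> \<phi> (grad \<phi>)"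
  unfolding has_weak_grad_def
proof (intro conjI ballI allI)
  note P = test_funD[OF \<phi>]
  show "\<phi> \<in> L1_loc \<Omega>" by (rule continuous_imp_L1_loc[OF P(3)])
  show "grad \<phi> \<in> L1_loc \<Omega>" by (rule continuous_imp_L1_loc[OF continuous_grad[OF \<phi>]])
  fix \<psi> i assume \<psi>: "\<psi> \<in> test_fun \<Omega>"
  note Q = test_funD[OF \<psi>]
  obtain K where K: "compact K" "K \<subseteq> \<Omega>"
    and z: "\<And>x. x \<notin> K \<Longrightarrow> \<psi> x = 0" "\<And>i x. x \<notin> K \<Longrightarrow> partial_deriv i \<psi> x = 0"
    using test_fun_support[OF \<psi>] by metis
  have pd: "partial_deriv i (\<lambda>x. \<phi> x * \<psi> x) = (\<lambda>x. \<phi> x * partial_deriv i \<psi> x + partial_deriv i \<phi> x * \<psi> x)"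
    by (rule ext) (rule partial_deriv_mult[OF P(2) Q(2)])
  have "closure {x. \<phi> x * \<psi> x \<noteq> 0} \<subseteq> K"
    using compact_imp_closed[OF K(1)] z(1) by (intro closure_minimal) auto
  then have Kc: "compact (closure {x. \<phi> x * \<psi> x \<noteq> 0})"
    using compact_Int_closed[OF K(1) closed_closure, of "{x. \<phi> x * \<psi> x \<noteq> 0}"]
    by (simp add: Int_absorb1)
  have i1: "integrable (lebesgue_on \<Omega>) (\<lambda>x. \<phi> x * partial_deriv i \<psi> x)"
    by (rule integrable_L1_loc_mult[OF \<Omega> continuous_imp_L1_loc[OF P(3)] K Q(4) z(2)])
  have i2: "integrable (lebesgue_on \<Omega>) (\<lambda>x. partial_deriv i \<phi> x * \<psi> x)"
    by (rule integrable_L1_loc_mult[OF \<Omega> continuous_imp_L1_loc[OF P(4)] K Q(3) z(1)])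
  have "(\<integral>x. partial_deriv i (\<lambda>x. \<phi> x * \<psi> x) x \<partial>lebesgue) = 0"
  proof (rule integral_partial_deriv_eq_0[OF _ _ Kc])
    show "(\<lambda>x. \<phi> x * \<psi> x) differentiable at x" for x
      by (rule differentiable_mult[OF P(2) Q(2)])
    show "continuous_on UNIV (partial_deriv i (\<lambda>x. \<phi> x * \<psi> x))"
      unfolding pd by (intro continuous_on_add continuous_on_mult P(3,4) Q(3,4))
  qed
  then have "(\<integral>x. \<phi> x * partial_deriv i \<psi> x + partial_deriv i \<phi> x * \<psi> x \<partial>lebesgue) = 0"
    unfolding pd .
  then have "(\<integral>x. \<phi> x * partial_deriv i \<psi> x + partial_deriv i \<phi> x * \<psi> x \<partial>lebesgue_on \<Omega>) = 0"
    by (subst integral_lebesgue_on_supported(1)[OF \<Omega>]) (simp_all add: z z[OF contra_subsetD[OF K(2)]])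
  then show "(\<integral>x. \<phi> x * partial_deriv i \<psi> x \<partial>lebesgue_on \<Omega>)
               = - (\<integral>x. grad \<phi> x $ i * \<psi> x \<partial>lebesgue_on \<Omega>)"
    using Bochner_Integration.integral_add[OF i1 i2] by (simp add: grad_def eq_neg_iff_add_eq_0)
qed

lemma square_integrable_continuous_compact_support:
  fixes u :: "real^'n::finite \<Rightarrow> 'b::euclidean_space"
  assumes \<Omega>: "open \<Omega>" and u: "continuous_on UNIV u"
    and K: "compact K" "K \<subseteq> \<Omega>" and zero: "\<And>x. x \<notin> K \<Longrightarrow> u x = 0"
  shows "u \<in> L2 \<Omega>"
proof -
  have "continuous_on UNIV (\<lambda>x. (norm (u x))\<^sup>2)"
    by (intro continuous_on_power continuous_on_norm u)
  then have "integrable lebesgue (\<lambda>x. (norm (u x))\<^sup>2)"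
    by (rule integrable_continuous_compact_support[OF _ K(1)]) (simp add: zero)
  then have "integrable (lebesgue_on \<Omega>) (\<lambda>x. (norm (u x))\<^sup>2)"
    using zero K by (subst integral_lebesgue_on_supported(2)[OF \<Omega>]) auto
  moreover have "u \<in> borel_measurable lebesgue"
    using u by (simp add: borel_measurable_continuous_onI measurable_completion)
  ultimately show ?thesis
    by (simp add: L2_def measurable_restrict_space1)
qed

lemma test_fun_L2:
  assumes "open \<Omega>" "\<phi> \<in> test_fun \<Omega>"
  shows "\<phi> \<in> L2 \<Omega>" "grad \<phi> \<in> L2 \<Omega>"
proof -
  obtain K where K: "compact K" "K \<subseteq> \<Omega>"
    and z: "\<And>x. x \<notin> K \<Longrightarrow> \<phi> x = 0" "\<And>i x. x \<notin> K \<Longrightarrow> partial_deriv i \<phi> x = 0"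
    using test_fun_support[OF assms(2)] by metis
  show "\<phi> \<in> L2 \<Omega>"
    by (rule square_integrable_continuous_compact_support[OF assms(1) test_funD(3)[OF assms(2)] K z(1)])
  show "grad \<phi> \<in> L2 \<Omega>"
    by (rule square_integrable_continuous_compact_support[OF assms(1) continuous_grad[OF assms(2)] K])
      (simp add: grad_def z(2) vec_eq_iff)
qed

section \<open>The fundamental lemma of the calculus of variations\<close>

text \<open>Smooth and positive exactly on the open box; the growing factor \<open>Suc k\<close> makes it
  converge to the indicator of the box. Boxes are used because they are stable under intersection
  and generate the Borel sets.\<close>

definition box_bump :: "nat \<Rightarrow> real^'n::finite \<Rightarrow> real^'n \<Rightarrow> real^'n \<Rightarrow> real" where
  "box_bump k a b x = (\<Prod>j\<in>UNIV. flat_exp 1 (real (Suc k) * (x $ j - a $ j)) *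
                                   flat_exp 1 (real (Suc k) * (b $ j - x $ j)))"

lemma flat_exp_1: "flat_exp 1 t = (if t > 0 then exp (- (1 / t)) else 0)"
  by (simp add: flat_exp_def)

lemma box_bump_bounds: "0 \<le> box_bump k a b x" "box_bump k a b x \<le> 1"
  unfolding box_bump_def
  by (auto intro!: prod_nonneg prod_le_1 mult_nonneg_nonneg mult_le_one simp: flat_exp_1)

lemma box_bump_eq_0: "x \<notin> box a b \<Longrightarrow> box_bump k a b x = 0"
  unfolding box_bump_def
  by (auto simp: mem_box_cart flat_exp_1 zero_less_mult_iff intro!: prod_zero)

lemma box_bump_tendsto: "(\<lambda>k. box_bump k a b x) \<longlonglongrightarrow> indicator (box a b) x"
proof (cases "x \<in> box a b")
  case True
  have lim: "(\<lambda>k. flat_exp 1 (real (Suc k) * c)) \<longlonglongrightarrow> 1" if "c > 0" for c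
  proof -
    have "(\<lambda>k. exp (- (inverse (real (Suc k)) * inverse c))) \<longlonglongrightarrow> exp (- (0 * inverse c))"
      by (intro tendsto_intros LIMSEQ_inverse_real_of_nat)
    then show ?thesis using that
      by (simp add: flat_exp_1 inverse_eq_divide zero_less_mult_iff del: of_nat_Suc)
  qed
  have "(\<lambda>k. box_bump k a b x) \<longlonglongrightarrow> (\<Prod>j\<in>(UNIV::'a set). 1 * 1)"
    unfolding box_bump_def
    by (intro tendsto_prod tendsto_mult lim) (use True in \<open>auto simp: mem_box_cart\<close>)
  then show ?thesis using True by simp
qed (simp add: box_bump_eq_0)

lemma box_bump_test_fun:
  assumes "cbox a b \<subseteq> \<Omega>"
  shows "box_bump k a b \<in> test_fun \<Omega>"
proof -
  have f1: "flat_exp 1 \<in> range flat_exp" by blast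
  have aff: "C_diff m (\<lambda>x. flat_exp 1 (c * (x $ j) + d))" for m c d and j :: 'a
    by (rule C_diff_compose[OF smooth_family_flat_exp f1 C_diff_affine])
  have eq: "box_bump k a b = (\<lambda>x. \<Prod>j\<in>UNIV.
      flat_exp 1 (real (Suc k) * (x $ j) + - (real (Suc k) * a $ j)) *
      flat_exp 1 (- real (Suc k) * (x $ j) + real (Suc k) * b $ j))"
    unfolding box_bump_def by (intro ext prod.cong refl arg_cong2[where f = "(*)"] arg_cong[where f = "flat_exp 1"])
      (simp_all add: algebra_simps)
  have "C_diff m (box_bump k a b)" for m
    unfolding eq by (intro C_diff_prod finite C_diff_mult aff)
  moreover have "{x. box_bump k a b x \<noteq> 0} \<subseteq> cbox a b"
    using box_bump_eq_0[of _ a b k] box_subset_cbox by auto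
  then have "closure {x. box_bump k a b x \<noteq> 0} \<subseteq> cbox a b"
    by (simp add: closure_minimal closed_cbox)
  moreover from this have "compact (closure {x. box_bump k a b x \<noteq> 0})"
    using compact_Int_closed[OF compact_cbox closed_closure, of a b "{x. box_bump k a b x \<noteq> 0}"]
    by (simp add: Int_absorb1)
  ultimately show ?thesis using assms by (auto simp: test_fun_def)
qed

text \<open>The Borel sets over which the integral vanishes form a Dynkin system containing the boxes; the
  assumption on the total integral gives closure under complements. The function is first replaced by
  a Borel representative, since the boxes do not generate the Lebesgue sets.\<close>

lemma AE_eq_0_if_box_integrals_eq_0:
  fixes w :: "'a::euclidean_space \<Rightarrow> real"
  assumes int: "integrable lebesgue w"
    and total: "(\<integral>x. w x \<partial>lebesgue) = 0"
    and boxes: "\<And>a b. (\<integral>x. indicator (box a b) x * w x \<partial>lebesgue) = 0"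
  shows "AE x in lebesgue. w x = 0"
proof -
  obtain v where v: "v \<in> borel_measurable lborel" and wv: "AE x in lborel. w x = v x"
    using completion_ex_borel_measurable_real[OF borel_measurable_integrable[OF int]] by blast
  have wv': "AE x in lebesgue. w x = v x" by (rule AE_completion[OF wv])
  have vm: "v \<in> borel_measurable lebesgue" using v by (rule measurable_completion)
  have "integrable lebesgue v"
    using integrable_cong_AE[OF borel_measurable_integrable[OF int] vm wv'] int by simp
  then have vint: "integrable lborel v" using v by (simp add: integrable_completion)
  have eq: "(\<integral>x. indicator A x * v x \<partial>lborel) = (\<integral>x. indicator A x * w x \<partial>lebesgue)"
    if "A \<in> sets borel" for A
  proof -
    have "(\<integral>x. indicator A x * v x \<partial>lborel) = (\<integral>x. indicator A x * v x \<partial>lebesgue)"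
      using v that by (intro integral_completion[symmetric] borel_measurable_times borel_measurable_indicator) auto
    also have "\<dots> = (\<integral>x. indicator A x * w x \<partial>lebesgue)"
      using vm borel_measurable_integrable[OF int] that wv'
      by (intro integral_cong_AE borel_measurable_times borel_measurable_indicator) auto
    finally show ?thesis .
  qed
  have set_int: "set_integrable lborel A v" if "A \<in> sets borel" for A
    using integrable_mult_indicator[OF _ vint, of A] that by (simp add: set_integrable_def)
  have zero: "set_lebesgue_integral lborel A v = 0" if "A \<in> sets borel" for A
  proof -
    let ?G = "range (\<lambda>(a, b). box a b :: 'a set)"
    have stable: "Int_stable ?G"
      by (force simp: Int_stable_def box_Int_box)
    have "A \<in> sigma_sets UNIV ?G"
      using that by (simp add: borel_eq_box)
    from stable subset_UNIV[of ?G, folded Pow_UNIV] this show ?thesis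
    proof (induction A rule: sigma_sets_induct_disjoint)
      fix A assume "A \<in> ?G"
      then show "set_lebesgue_integral lborel A v = 0"
        using boxes by (auto simp: set_lebesgue_integral_def eq)
    next
      show "set_lebesgue_integral lborel {} v = 0" by (simp add: set_lebesgue_integral_def)
    next
      fix A assume "A \<in> sigma_sets UNIV ?G"
        and IH: "set_lebesgue_integral lborel A v = 0"
      then have A: "A \<in> sets borel" by (simp add: borel_eq_box)
      have "set_lebesgue_integral lborel UNIV v = 0"
        using total eq[of UNIV] by (simp add: set_lebesgue_integral_def)
      moreover have "set_lebesgue_integral lborel (A \<union> (UNIV - A)) v
          = set_lebesgue_integral lborel A v + set_lebesgue_integral lborel (UNIV - A) v"
        using A by (intro set_integral_Un set_int) auto
      ultimately show "set_lebesgue_integral lborel (UNIV - A) v = 0"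
        using IH by simp
    next
      fix A :: "nat \<Rightarrow> 'a set"
      assume disj: "disjoint_family A"
        and "range A \<subseteq> sigma_sets UNIV ?G"
        and IH: "\<And>i. set_lebesgue_integral lborel (A i) v = 0"
      then have "\<And>i. A i \<in> sets borel" by (auto simp: borel_eq_box)
      then show "set_lebesgue_integral lborel (\<Union>i. A i) v = 0"
        using disj IH by (subst lebesgue_integral_countable_add) (auto simp: disjoint_family_on_def set_int)
    qed
  qed
  have "AE x in lborel. v x = 0"
    by (rule sigma_finite_measure.density_unique_banach[OF lborel.sigma_finite_measure_axioms vint integrable_zero]) (use zero in \<open>auto simp: set_lebesgue_integral_def\<close>)
  then have "AE x in lebesgue. v x = 0" by (rule AE_completion)
  with wv' show ?thesis by eventually_elim simp
qed

text \<open>Testing against bumps and letting them increase to the indicator of a box shows that \<open>w\<close> has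
  integral \<open>0\<close> over every box whose closure lies in \<open>\<Omega>\<close>. Hence \<open>w\<close> vanishes almost
  everywhere on each such box, and countably many of them cover \<open>\<Omega>\<close>.\<close>

lemma AE_eq_0_if_orthogonal_to_test_funs:
  fixes w :: "real^'n::finite \<Rightarrow> real"
  assumes \<Omega>: "open \<Omega>" and w: "w \<in> L1_loc \<Omega>"
    and orth: "\<And>\<phi>. \<phi> \<in> test_fun \<Omega> \<Longrightarrow> (\<integral>x. w x * \<phi> x \<partial>lebesgue_on \<Omega>) = 0"
  shows "AE x in lebesgue_on \<Omega>. w x = 0"
proof -
  have cint: "integrable lebesgue (\<lambda>x. indicator (cbox a b) x * w x)" if "cbox a b \<subseteq> \<Omega>" for a b
    using w that compact_cbox[of a b] by (simp add: L1_loc_def set_integrable_def)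
  have bint: "integrable lebesgue (\<lambda>x. indicator (box a b) x * w x)" if "cbox a b \<subseteq> \<Omega>" for a b
    using set_integrable_subset[of lebesgue "cbox a b" w "box a b"] cint[OF that] box_subset_cbox[of a b]
    by (simp add: set_integrable_def)
  have bump_lim: "(\<integral>x. indicator (box a b) x * w x \<partial>lebesgue) = 0" if "cbox a b \<subseteq> \<Omega>" for a b
  proof -
    have bump: "box_bump k a b \<in> test_fun \<Omega>" for k
      by (rule box_bump_test_fun[OF that])
    have out: "w x * box_bump k a b x = 0" if "x \<notin> \<Omega>" for k x
      using that box_bump_eq_0[of x a b k] \<open>cbox a b \<subseteq> \<Omega>\<close> box_subset_cbox[of a b] by auto
    have zero: "(\<integral>x. w x * box_bump k a b x \<partial>lebesgue) = 0" for k
      using orth[OF bump, of k] integral_lebesgue_on_supported(1)[OF \<Omega> out[where k = k]] by simp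
    have factor: "w x * box_bump k a b x = (indicator (box a b) x * w x) * box_bump k a b x" for x k
      using box_bump_eq_0[of x a b k] by (cases "x \<in> box a b") auto
    have "(\<lambda>k. \<integral>x. w x * box_bump k a b x \<partial>lebesgue) \<longlonglongrightarrow> (\<integral>x. indicator (box a b) x * w x \<partial>lebesgue)"
    proof (rule integral_dominated_convergence)
      note m = borel_measurable_integrable[OF bint[OF that]]
      show "(\<lambda>x. indicator (box a b) x * w x) \<in> borel_measurable lebesgue" by (rule m)
      show "(\<lambda>x. w x * box_bump k a b x) \<in> borel_measurable lebesgue" for k
        unfolding factor
        by (intro borel_measurable_times[OF m] continuous_imp_borel_measurable_lebesgue test_funD(3)[OF bump])
      show "integrable lebesgue (\<lambda>x. norm (indicator (box a b) x * w x))"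
        using bint[OF that] by (rule integrable_norm)
      have "(\<lambda>k. w x * box_bump k a b x) \<longlonglongrightarrow> w x * indicator (box a b) x" for x
        by (intro tendsto_mult_left box_bump_tendsto)
      then show "AE x in lebesgue. (\<lambda>k. w x * box_bump k a b x) \<longlonglongrightarrow> indicator (box a b) x * w x"
        by (simp add: mult.commute)
      have "norm (w x * box_bump k a b x) \<le> norm (indicator (box a b) x * w x)" for k x
        unfolding factor norm_mult using box_bump_bounds[of k a b x]
        by (intro mult_right_le_one_le) auto
      then show "AE x in lebesgue. norm (w x * box_bump k a b x) \<le> norm (indicator (box a b) x * w x)" for k
        by simp
    qed
    then show ?thesis by (simp add: zero LIMSEQ_const_iff)
  qed
  have local_zero: "AE x in lebesgue. x \<in> cbox a b \<longrightarrow> w x = 0" if ab: "cbox a b \<subseteq> \<Omega>" for a b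
  proof -
    have "AE x in lebesgue. indicator (box a b) x * w x = 0"
    proof (rule AE_eq_0_if_box_integrals_eq_0[OF bint[OF ab] bump_lim[OF ab]])
      fix c d :: "real^'n"
      obtain p q where pq: "box c d \<inter> box a b = box p q" by (rule that[OF box_Int_box])
      have eq: "(\<lambda>x. indicator (box c d) x * (indicator (box a b) x * w x)) = (\<lambda>x. indicator (box p q) x * w x)"
        unfolding pq[symmetric] by (auto simp: indicator_def)
      show "(\<integral>x. indicator (box c d) x * (indicator (box a b) x * w x) \<partial>lebesgue) = 0"
      proof (cases "box p q = {}")
        case False
        then have "cbox p q = closure (box p q)" by simp
        \<comment> \<open>nonempty boxes only: the closed box of an empty open box may leave \<open>\<Omega>\<close>\<close>
        also have "\<dots> \<subseteq> cbox a b"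
          unfolding pq[symmetric] using box_subset_cbox[of a b] by (intro closure_minimal) auto
        finally show ?thesis unfolding eq using ab by (intro bump_lim) simp
      qed (simp add: eq)
    qed
    moreover have "AE x in lebesgue. x \<notin> cbox a b - box a b"
      using negligible_frontier_interval[of a b] by (intro AE_not_in) (simp add: negligible_iff_null_sets)
    ultimately show ?thesis by eventually_elim (auto simp: indicator_def split: if_splits)
  qed
  obtain \<D> where \<D>: "countable \<D>" "\<D> \<subseteq> Pow \<Omega>" "\<And>X. X \<in> \<D> \<Longrightarrow> \<exists>a b. X = cbox a b" "\<Union>\<D> = \<Omega>"
    using open_countable_Union_open_cbox[OF \<Omega>] by metis
  have "AE x in lebesgue. \<forall>X\<in>\<D>. x \<in> X \<longrightarrow> w x = 0"
  proof (rule AE_ball_countable'[OF _ \<D>(1)])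
    fix X assume "X \<in> \<D>"
    with \<D> obtain a b where "X = cbox a b" "cbox a b \<subseteq> \<Omega>" by blast
    then show "AE x in lebesgue. x \<in> X \<longrightarrow> w x = 0" using local_zero by simp
  qed
  then have "AE x in lebesgue. x \<in> \<Omega> \<longrightarrow> w x = 0"
    by eventually_elim (use \<D>(4) in blast)
  then show ?thesis using \<Omega> by (subst AE_restrict_space_iff) auto
qed

section \<open>Weak gradients and Sobolev norms\<close>

text \<open>Equality of the integrals of almost everywhere equal functions needs both to be measurable;
  completeness of Lebesgue measure supplies this for a weak gradient chosen by \<open>weak_grad\<close>.\<close>

lemma borel_measurable_AE_cong_lebesgue_on:
  fixes f h :: "real^'n::finite \<Rightarrow> 'b::topological_space"
  assumes \<Omega>: "open \<Omega>" and f: "f \<in> borel_measurable (lebesgue_on \<Omega>)"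
    and eq: "AE x in lebesgue_on \<Omega>. f x = h x"
  shows "h \<in> borel_measurable (lebesgue_on \<Omega>)"
proof (rule measurableI)
  fix S :: "'b set" assume S: "S \<in> sets borel"
  have [simp]: "\<Omega> \<in> sets lebesgue" using \<Omega> by auto
  have "f -` S \<inter> \<Omega> \<in> sets (lebesgue_on \<Omega>)"
    using measurable_sets[OF f S] by simp
  then have meas: "f -` S \<inter> \<Omega> \<in> sets lebesgue"
    by (simp add: sets_restrict_space_iff)
  have "AE x in lebesgue. x \<in> \<Omega> \<longrightarrow> f x = h x"
    using eq by (simp add: AE_restrict_space_iff)
  then have "AE x in lebesgue. x \<in> f -` S \<inter> \<Omega> \<longleftrightarrow> x \<in> h -` S \<inter> \<Omega>"
    by eventually_elim auto
  then have "h -` S \<inter> \<Omega> \<in> sets lebesgue"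
    by (rule completion.in_sets_AE[OF _ meas]) simp
  then show "h -` S \<inter> space (lebesgue_on \<Omega>) \<in> sets (lebesgue_on \<Omega>)"
    by (simp add: sets_restrict_space_iff)
qed simp

lemma L2_AE_cong:
  assumes \<Omega>: "open \<Omega>" and u: "u \<in> L2 \<Omega>" and eq: "AE x in lebesgue_on \<Omega>. u x = v x"
  shows "v \<in> L2 \<Omega>" "L2_norm \<Omega> v = L2_norm \<Omega> u"
proof -
  have um: "u \<in> borel_measurable (lebesgue_on \<Omega>)" and ui: "integrable (lebesgue_on \<Omega>) (\<lambda>x. (norm (u x))\<^sup>2)"
    using u by (auto simp: L2_def)
  have vm: "v \<in> borel_measurable (lebesgue_on \<Omega>)"
    by (rule borel_measurable_AE_cong_lebesgue_on[OF \<Omega> um eq])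
  have eq2: "AE x in lebesgue_on \<Omega>. (norm (u x))\<^sup>2 = (norm (v x))\<^sup>2"
    using eq by eventually_elim simp
  have m: "(\<lambda>x. (norm (u x))\<^sup>2) \<in> borel_measurable (lebesgue_on \<Omega>)"
      "(\<lambda>x. (norm (v x))\<^sup>2) \<in> borel_measurable (lebesgue_on \<Omega>)"
    using um vm by measurable
  show "v \<in> L2 \<Omega>"
    using integrable_cong_AE[OF m eq2] ui vm by (simp add: L2_def)
  show "L2_norm \<Omega> v = L2_norm \<Omega> u"
    using integral_cong_AE[OF m eq2] by (simp add: L2_norm_def)
qed

lemma L1_loc_diff: "u \<in> L1_loc \<Omega> \<Longrightarrow> v \<in> L1_loc \<Omega> \<Longrightarrow> (\<lambda>x. u x - v x) \<in> L1_loc \<Omega>"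
  by (auto simp: L1_loc_def intro!: set_integral_diff)

lemma L1_loc_nth:
  assumes "G \<in> L1_loc \<Omega>" shows "(\<lambda>x. G x $ i) \<in> L1_loc \<Omega>"
  unfolding L1_loc_def
proof (intro CollectI allI impI)
  fix K assume "compact K \<and> K \<subseteq> \<Omega>"
  then have "integrable lebesgue (\<lambda>x. indicat_real K x *\<^sub>R G x)"
    using assms by (simp add: L1_loc_def set_integrable_def)
  from integrable_bounded_linear[OF bounded_linear_vec_nth this, of i]
  show "set_integrable lebesgue K (\<lambda>x. G x $ i)" by (simp add: set_integrable_def)
qed

lemma has_weak_grad_diff:
  assumes \<Omega>: "open \<Omega>" and uG: "has_weak_grad \<Omega> u G" and vH: "has_weak_grad \<Omega> v H"
  shows "has_weak_grad \<Omega> (\<lambda>x. u x - v x) (\<lambda>x. G x - H x)"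
  unfolding has_weak_grad_def
proof (intro conjI ballI allI)
  show "(\<lambda>x. u x - v x) \<in> L1_loc \<Omega>" "(\<lambda>x. G x - H x) \<in> L1_loc \<Omega>"
    using uG vH by (auto simp: has_weak_grad_def intro: L1_loc_diff)
  fix \<phi> i assume \<phi>: "\<phi> \<in> test_fun \<Omega>"
  obtain K where K: "compact K" "K \<subseteq> \<Omega>"
    and z: "\<And>x. x \<notin> K \<Longrightarrow> \<phi> x = 0" "\<And>i x. x \<notin> K \<Longrightarrow> partial_deriv i \<phi> x = 0"
    using test_fun_support[OF \<phi>] by metis
  have i1: "integrable (lebesgue_on \<Omega>) (\<lambda>x. w x * partial_deriv i \<phi> x)" if "w \<in> L1_loc \<Omega>" for w
    by (rule integrable_L1_loc_mult[OF \<Omega> that K test_funD(4)[OF \<phi>] z(2)])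
  have i2: "integrable (lebesgue_on \<Omega>) (\<lambda>x. w x * \<phi> x)" if "w \<in> L1_loc \<Omega>" for w
    by (rule integrable_L1_loc_mult[OF \<Omega> that K test_funD(3)[OF \<phi>] z(1)])
  have L: "u \<in> L1_loc \<Omega>" "v \<in> L1_loc \<Omega>" "(\<lambda>x. G x $ i) \<in> L1_loc \<Omega>" "(\<lambda>x. H x $ i) \<in> L1_loc \<Omega>"
    using uG vH by (auto simp: has_weak_grad_def intro: L1_loc_nth)
  have "(\<integral>x. u x * partial_deriv i \<phi> x \<partial>lebesgue_on \<Omega>) = - (\<integral>x. G x $ i * \<phi> x \<partial>lebesgue_on \<Omega>)"
       "(\<integral>x. v x * partial_deriv i \<phi> x \<partial>lebesgue_on \<Omega>) = - (\<integral>x. H x $ i * \<phi> x \<partial>lebesgue_on \<Omega>)"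
    using uG vH \<phi> by (simp_all add: has_weak_grad_def)
  then show "(\<integral>x. (u x - v x) * partial_deriv i \<phi> x \<partial>lebesgue_on \<Omega>)
               = - (\<integral>x. (G x - H x) $ i * \<phi> x \<partial>lebesgue_on \<Omega>)"
    using L by (simp add: left_diff_distrib i1 i2)
qed

lemma has_weak_grad_unique:
  assumes \<Omega>: "open \<Omega>" and "has_weak_grad \<Omega> u G" "has_weak_grad \<Omega> u H"
  shows "AE x in lebesgue_on \<Omega>. G x = H x"
proof -
  have D: "has_weak_grad \<Omega> (\<lambda>x. 0) (\<lambda>x. G x - H x)"
    using has_weak_grad_diff[OF assms] by simp
  have "AE x in lebesgue_on \<Omega>. \<forall>i\<in>UNIV. (G x - H x) $ i = 0"
  proof (rule AE_finite_allI[OF finite], rule AE_eq_0_if_orthogonal_to_test_funs[OF \<Omega>])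
    fix i
    show "(\<lambda>x. (G x - H x) $ i) \<in> L1_loc \<Omega>"
      using D by (intro L1_loc_nth) (simp add: has_weak_grad_def)
    fix \<phi> assume "\<phi> \<in> test_fun \<Omega>"
    then have "(\<integral>x. 0 * partial_deriv i \<phi> x \<partial>lebesgue_on \<Omega>) = - (\<integral>x. (G x - H x) $ i * \<phi> x \<partial>lebesgue_on \<Omega>)"
      using D unfolding has_weak_grad_def by blast
    then show "(\<integral>x. (G x - H x) $ i * \<phi> x \<partial>lebesgue_on \<Omega>) = 0" by simp
  qed
  then show ?thesis by eventually_elim (simp add: vec_eq_iff)
qed

lemma has_weak_grad_weak_grad: "has_weak_grad \<Omega> u G \<Longrightarrow> has_weak_grad \<Omega> u (weak_grad \<Omega> u)"
  unfolding weak_grad_def by (rule someI[where P = "has_weak_grad \<Omega> u"])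

lemma weak_grad_eq:
  assumes "open \<Omega>" "has_weak_grad \<Omega> u G" "G \<in> L2 \<Omega>"
  shows "weak_grad \<Omega> u \<in> L2 \<Omega>" "L2_norm \<Omega> (weak_grad \<Omega> u) = L2_norm \<Omega> G"
  using L2_AE_cong[OF assms(1,3)
      has_weak_grad_unique[OF assms(1,2) has_weak_grad_weak_grad[OF assms(2)]]] by simp_all

lemma H1D:
  assumes "open \<Omega>" "u \<in> H1 \<Omega>"
  shows "u \<in> L2 \<Omega>" "has_weak_grad \<Omega> u (weak_grad \<Omega> u)" "weak_grad \<Omega> u \<in> L2 \<Omega>"
  using assms weak_grad_eq(1)[OF assms(1)] has_weak_grad_weak_grad by (auto simp: H1_def)

lemma L2_norm_sq: "(L2_norm \<Omega> u)\<^sup>2 = (\<integral>x. (norm (u x))\<^sup>2 \<partial>lebesgue_on \<Omega>)"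
  by (simp add: L2_norm_def integral_nonneg_AE)

lemma H1_norm_sq: "(H1_norm \<Omega> u)\<^sup>2 = (L2_norm \<Omega> u)\<^sup>2 + (L2_norm \<Omega> (weak_grad \<Omega> u))\<^sup>2"
  by (simp add: H1_norm_def)

lemma test_fun_in_H10:
  assumes \<Omega>: "open \<Omega>" and \<phi>: "\<phi> \<in> test_fun \<Omega>"
  shows "\<phi> \<in> H10 \<Omega>"
proof -
  note W = has_weak_grad_test_fun[OF assms] and L = test_fun_L2[OF assms]
  have H1: "\<phi> \<in> H1 \<Omega>" using L W by (auto simp: H1_def)
  have W0: "has_weak_grad \<Omega> (\<lambda>x. \<phi> x - \<phi> x) (\<lambda>x. 0)"
    using has_weak_grad_diff[OF \<Omega> W W] by simp
  have "L2_norm \<Omega> (weak_grad \<Omega> (\<lambda>x. \<phi> x - \<phi> x)) = L2_norm \<Omega> (\<lambda>x. 0 :: real^'a)"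
    by (rule weak_grad_eq(2)[OF \<Omega> W0]) (simp add: L2_def)
  then have "H1_norm \<Omega> (\<lambda>x. \<phi> x - \<phi> x) = 0"
    by (simp add: H1_norm_def L2_norm_def)
  then show ?thesis unfolding H10_def using H1 \<phi> by (auto intro!: bexI[of _ \<phi>])
qed

text \<open>A weighted triangle inequality for squares. Integrating it pointwise takes the place of
  Minkowski's inequality in \<open>L\<^sup>2\<close>.\<close>

lemma norm_sq_le_weighted:
  fixes a b :: "'a::real_inner"
  assumes "t > 0"
  shows "(norm a)\<^sup>2 \<le> (1 + t) * (norm b)\<^sup>2 + (1 + 1 / t) * (norm (a - b))\<^sup>2"
proof -
  have "norm a \<le> norm b + norm (a - b)" by (metis add.commute diff_add_cancel norm_triangle_ineq)
  then have "(norm a)\<^sup>2 \<le> (norm b + norm (a - b))\<^sup>2" by (simp add: power_mono)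
  moreover have "0 \<le> (sqrt t * norm b - norm (a - b) / sqrt t)\<^sup>2" by simp
  then have "2 * norm b * norm (a - b) \<le> t * (norm b)\<^sup>2 + (norm (a - b))\<^sup>2 / t"
    using assms by (simp add: power2_diff power_mult_distrib power_divide)
  ultimately show ?thesis by (simp add: power2_sum algebra_simps)
qed

lemma L2_diff:
  assumes "u \<in> L2 \<Omega>" "v \<in> L2 \<Omega>"
  shows "(\<lambda>x. u x - v x) \<in> L2 \<Omega>"
proof -
  have m: "u \<in> borel_measurable (lebesgue_on \<Omega>)" "v \<in> borel_measurable (lebesgue_on \<Omega>)"
    and i: "integrable (lebesgue_on \<Omega>) (\<lambda>x. (norm (u x))\<^sup>2)" "integrable (lebesgue_on \<Omega>) (\<lambda>x. (norm (v x))\<^sup>2)"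
    using assms by (auto simp: L2_def)
  have "integrable (lebesgue_on \<Omega>) (\<lambda>x. (norm (u x - v x))\<^sup>2)"
  proof (rule Bochner_Integration.integrable_bound)
    show "integrable (lebesgue_on \<Omega>) (\<lambda>x. 2 * (norm (u x))\<^sup>2 + 2 * (norm (v x))\<^sup>2)"
      using i by simp
    show "(\<lambda>x. (norm (u x - v x))\<^sup>2) \<in> borel_measurable (lebesgue_on \<Omega>)"
      using m by measurable
    have "(norm (u x - v x))\<^sup>2 \<le> 2 * (norm (u x))\<^sup>2 + 2 * (norm (v x))\<^sup>2" for x
      using norm_sq_le_weighted[of 1 "u x - v x" "u x"] by simp
    then show "AE x in lebesgue_on \<Omega>. norm ((norm (u x - v x))\<^sup>2) \<le> norm (2 * (norm (u x))\<^sup>2 + 2 * (norm (v x))\<^sup>2)"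
      by simp
  qed
  then show ?thesis using m by (simp add: L2_def)
qed

lemma L2_norm_sq_le_weighted:
  assumes u: "u \<in> L2 \<Omega>" and v: "v \<in> L2 \<Omega>" and "t > 0"
  shows "(L2_norm \<Omega> u)\<^sup>2 \<le> (1 + t) * (L2_norm \<Omega> v)\<^sup>2 + (1 + 1 / t) * (L2_norm \<Omega> (\<lambda>x. u x - v x))\<^sup>2"
proof -
  have i: "integrable (lebesgue_on \<Omega>) (\<lambda>x. (norm (u x))\<^sup>2)" "integrable (lebesgue_on \<Omega>) (\<lambda>x. (norm (v x))\<^sup>2)"
      "integrable (lebesgue_on \<Omega>) (\<lambda>x. (norm (u x - v x))\<^sup>2)"
    using u v L2_diff[OF u v] by (simp_all add: L2_def)
  have "(\<integral>x. (norm (u x))\<^sup>2 \<partial>lebesgue_on \<Omega>)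
      \<le> (\<integral>x. (1 + t) * (norm (v x))\<^sup>2 + (1 + 1 / t) * (norm (u x - v x))\<^sup>2 \<partial>lebesgue_on \<Omega>)"
    using i norm_sq_le_weighted[OF \<open>t > 0\<close>] by (intro integral_mono) auto
  then show ?thesis using i by (simp add: L2_norm_sq)
qed

section \<open>Passing the spectral bound to the closure\<close>

text \<open>Approximate \<open>u\<close> by a test function within distance \<open>t\<close> and compare both norms by the weighted
  inequality with the same parameter \<open>t\<close>. The error terms are then of size \<open>(1 + 1 / t) t\<^sup>2 = t\<^sup>2 + t\<close>,
  so they vanish as \<open>t\<close> tends to \<open>0\<close>.\<close>

lemma gradient_lower_bound_H10:
  assumes \<Omega>: "open \<Omega>" and u: "u \<in> H10 \<Omega>"
    and bound: "\<And>\<phi>. \<phi> \<in> test_fun \<Omega> \<Longrightarrow> \<Lambda> * (L2_norm \<Omega> \<phi>)\<^sup>2 \<le> (L2_norm \<Omega> (grad \<phi>))\<^sup>2"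
  shows "\<Lambda> * (L2_norm \<Omega> u)\<^sup>2 \<le> (L2_norm \<Omega> (weak_grad \<Omega> u))\<^sup>2"
proof (cases "\<Lambda> \<ge> 0")
  case False
  then have "\<Lambda> * (L2_norm \<Omega> u)\<^sup>2 \<le> 0" by (simp add: mult_nonpos_nonneg)
  then show ?thesis by (rule order_trans) simp
next
  case True
  define a where "a = (L2_norm \<Omega> u)\<^sup>2"
  define A where "A = (L2_norm \<Omega> (weak_grad \<Omega> u))\<^sup>2"
  have uH: "u \<in> H1 \<Omega>" using u by (simp add: H10_def)
  note U = H1D[OF \<Omega> uH]
  have est: "\<Lambda> * a \<le> (1 + t) * ((1 + t) * A + (1 + 1 / t) * t\<^sup>2) + \<Lambda> * ((1 + 1 / t) * t\<^sup>2)" if t: "t > 0" for t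
  proof -
    obtain \<phi> where \<phi>: "\<phi> \<in> test_fun \<Omega>" and close: "H1_norm \<Omega> (\<lambda>x. u x - \<phi> x) < t"
      using u t by (auto simp: H10_def)
    note L = test_fun_L2[OF \<Omega> \<phi>]
    have W: "L2_norm \<Omega> (weak_grad \<Omega> (\<lambda>x. u x - \<phi> x)) = L2_norm \<Omega> (\<lambda>x. weak_grad \<Omega> u x - grad \<phi> x)"
      by (rule weak_grad_eq(2)[OF \<Omega> has_weak_grad_diff[OF \<Omega> U(2) has_weak_grad_test_fun[OF \<Omega> \<phi>]]
            L2_diff[OF U(3) L(2)]])
    have "0 \<le> H1_norm \<Omega> (\<lambda>x. u x - \<phi> x)" by (simp add: H1_norm_def)
    then have "(H1_norm \<Omega> (\<lambda>x. u x - \<phi> x))\<^sup>2 \<le> t\<^sup>2" using close by (intro power_mono) auto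
    then have sum: "(L2_norm \<Omega> (\<lambda>x. u x - \<phi> x))\<^sup>2 + (L2_norm \<Omega> (\<lambda>x. weak_grad \<Omega> u x - grad \<phi> x))\<^sup>2 \<le> t\<^sup>2"
      by (simp add: H1_norm_sq W)
    have d1: "(L2_norm \<Omega> (\<lambda>x. u x - \<phi> x))\<^sup>2 \<le> t\<^sup>2"
      using sum zero_le_power2[of "L2_norm \<Omega> (\<lambda>x. weak_grad \<Omega> u x - grad \<phi> x)"] by linarith
    have swap: "L2_norm \<Omega> (\<lambda>x. grad \<phi> x - weak_grad \<Omega> u x) = L2_norm \<Omega> (\<lambda>x. weak_grad \<Omega> u x - grad \<phi> x)"
      by (simp add: L2_norm_def norm_minus_commute)
    have d2: "(L2_norm \<Omega> (\<lambda>x. grad \<phi> x - weak_grad \<Omega> u x))\<^sup>2 \<le> t\<^sup>2"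
      unfolding swap using sum zero_le_power2[of "L2_norm \<Omega> (\<lambda>x. u x - \<phi> x)"] by linarith
    have "a \<le> (1 + t) * (L2_norm \<Omega> \<phi>)\<^sup>2 + (1 + 1 / t) * (L2_norm \<Omega> (\<lambda>x. u x - \<phi> x))\<^sup>2"
      unfolding a_def by (rule L2_norm_sq_le_weighted[OF U(1) L(1) t])
    also have "\<dots> \<le> (1 + t) * (L2_norm \<Omega> \<phi>)\<^sup>2 + (1 + 1 / t) * t\<^sup>2"
      using d1 t by (intro add_left_mono mult_left_mono) auto
    finally have "\<Lambda> * a \<le> \<Lambda> * ((1 + t) * (L2_norm \<Omega> \<phi>)\<^sup>2 + (1 + 1 / t) * t\<^sup>2)"
      using True by (rule mult_left_mono)
    also have "\<dots> = (1 + t) * (\<Lambda> * (L2_norm \<Omega> \<phi>)\<^sup>2) + \<Lambda> * ((1 + 1 / t) * t\<^sup>2)"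
      by (simp add: algebra_simps)
    also have "\<dots> \<le> (1 + t) * (L2_norm \<Omega> (grad \<phi>))\<^sup>2 + \<Lambda> * ((1 + 1 / t) * t\<^sup>2)"
      using bound[OF \<phi>] t by (intro add_right_mono mult_left_mono) auto
    also have "(L2_norm \<Omega> (grad \<phi>))\<^sup>2 \<le> (1 + t) * A + (1 + 1 / t) * (L2_norm \<Omega> (\<lambda>x. grad \<phi> x - weak_grad \<Omega> u x))\<^sup>2"
      unfolding A_def by (rule L2_norm_sq_le_weighted[OF L(2) U(3) t])
    also have "\<dots> \<le> (1 + t) * A + (1 + 1 / t) * t\<^sup>2"
      using d2 t by (intro add_left_mono mult_left_mono) auto
    finally show ?thesis using t by (simp add: mult_left_mono)
  qed
  have "((\<lambda>t. (1 + t) * ((1 + t) * A + (t\<^sup>2 + t)) + \<Lambda> * (t\<^sup>2 + t)) \<longlongrightarrow>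
      (1 + 0) * ((1 + 0) * A + (0\<^sup>2 + 0)) + \<Lambda> * (0\<^sup>2 + 0)) (at_right 0)"
    by (intro tendsto_intros)
  moreover have "eventually (\<lambda>t. \<Lambda> * a \<le> (1 + t) * ((1 + t) * A + (t\<^sup>2 + t)) + \<Lambda> * (t\<^sup>2 + t)) (at_right 0)"
    unfolding eventually_at_filter
  proof (intro always_eventually allI impI)
    fix t :: real assume "t \<noteq> 0" "t \<in> {0<..}"
    then have t: "t > 0" by simp
    then have "(1 + 1 / t) * t\<^sup>2 = t\<^sup>2 + t" by (simp add: power2_eq_square field_simps)
    with est[OF t] show "\<Lambda> * a \<le> (1 + t) * ((1 + t) * A + (t\<^sup>2 + t)) + \<Lambda> * (t\<^sup>2 + t)" by simp
  qed
  ultimately have "\<Lambda> * a \<le> (1 + 0) * ((1 + 0) * A + (0\<^sup>2 + 0)) + \<Lambda> * (0\<^sup>2 + 0)"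
    by (intro tendsto_lowerbound) auto
  then show ?thesis by (simp add: a_def A_def)
qed

lemma fundamental_tone_lower_bound:
  assumes "ereal \<Lambda> \<le> fundamental_tone \<Omega>" "\<phi> \<in> test_fun \<Omega>"
  shows "\<Lambda> * (L2_norm \<Omega> \<phi>)\<^sup>2 \<le> (L2_norm \<Omega> (grad \<phi>))\<^sup>2"
proof (cases "L2_norm \<Omega> \<phi> = 0")
  case False
  have "\<exists>x. \<phi> x \<noteq> 0"
  proof (rule ccontr)
    assume "\<nexists>x. \<phi> x \<noteq> 0"
    then have "\<phi> = (\<lambda>x. 0)" by auto
    with False show False by (simp add: L2_norm_def)
  qed
  then have "fundamental_tone \<Omega> \<le> ereal ((L2_norm \<Omega> (grad \<phi>))\<^sup>2 / (L2_norm \<Omega> \<phi>)\<^sup>2)"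
    unfolding fundamental_tone_def using assms(2) by (intro INF_lower) auto
  with assms(1) have "\<Lambda> \<le> (L2_norm \<Omega> (grad \<phi>))\<^sup>2 / (L2_norm \<Omega> \<phi>)\<^sup>2"
    by (metis order_trans ereal_less_eq(3))
  then show ?thesis using False by (simp add: field_simps)
qed simp

text \<open>A quotient with zero denominator counts as \<open>0\<close>, so turning a Rayleigh quotient below
  \<open>\<lambda>\<close> into an inequality between norms needs a positive denominator. It is positive since a nonempty open set
  is not null.\<close>

lemma L2_norm_test_fun_pos:
  assumes \<Omega>: "open \<Omega>" and \<phi>: "\<phi> \<in> test_fun \<Omega>" and nz: "\<phi> x \<noteq> 0"
  shows "(L2_norm \<Omega> \<phi>)\<^sup>2 > 0"
proof (rule ccontr)
  assume "\<not> ?thesis"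
  then have "(\<integral>x. (norm (\<phi> x))\<^sup>2 \<partial>lebesgue_on \<Omega>) = 0"
    using zero_le_power2[of "L2_norm \<Omega> \<phi>"] unfolding L2_norm_sq by linarith
  moreover have "integrable (lebesgue_on \<Omega>) (\<lambda>x. (norm (\<phi> x))\<^sup>2)"
    using test_fun_L2(1)[OF \<Omega> \<phi>] by (simp add: L2_def)
  ultimately have "AE x in lebesgue_on \<Omega>. (norm (\<phi> x))\<^sup>2 = 0"
    by (subst (asm) integral_nonneg_eq_0_iff_AE) auto
  then have "AE x in lebesgue. x \<in> \<Omega> \<longrightarrow> \<phi> x = 0"
    using \<Omega> by (subst (asm) AE_restrict_space_iff) auto
  moreover have "x \<in> \<Omega>" if "\<phi> x \<noteq> 0" for x
    using that closure_subset[of "{x. \<phi> x \<noteq> 0}"] test_funD(6)[OF \<phi>] by auto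
  ultimately have "AE x in lebesgue. x \<notin> {x. \<phi> x \<noteq> 0}"
    by (auto elim!: eventually_mono)
  then have "negligible {x. \<phi> x \<noteq> 0}"
    by (simp add: negligible_iff_null_sets completion.null_sets_iff_AE)
  moreover have "open {x. \<phi> x \<noteq> 0}"
    using test_funD(3)[OF \<phi>] by (intro open_Collect_neq continuous_on_const)
  ultimately show False using nz open_not_negligible by blast
qed

section \<open>Coercivity and unboundedness of the functional\<close>

text \<open>Young's inequality gives \<open>\<bar>2 f u\<bar> \<le> \<delta> u\<^sup>2 + f\<^sup>2 / \<delta>\<close>, and bounded functions are integrable on a set of
  finite measure. The two-sided form serves both coercivity and unboundedness.\<close>

lemma J_fun_estimate:
  fixes f g :: "real^'n::finite \<Rightarrow> real"
  assumes "f \<in> Linf" "g \<in> Linf" and \<Omega>: "open \<Omega>" and fin: "emeasure lebesgue \<Omega> < \<infinity>" and \<delta>: "\<delta> > 0"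
  obtains C where "0 \<le> C" "\<And>u. u \<in> H1 \<Omega> \<Longrightarrow>
    \<bar>J_fun f g lam \<Omega> u - ((L2_norm \<Omega> (weak_grad \<Omega> u))\<^sup>2 - lam * (L2_norm \<Omega> u)\<^sup>2)\<bar>
      \<le> \<delta> * (L2_norm \<Omega> u)\<^sup>2 + C"
proof -
  have [simp]: "\<Omega> \<in> sets lebesgue" using \<Omega> by auto
  interpret fm: finite_measure "lebesgue_on \<Omega>"
    using fin by (intro finite_measureI) (simp add: emeasure_restrict_space less_top[symmetric])
  have bdd: "\<exists>B\<ge>0. AE x in lebesgue_on \<Omega>. \<bar>h x\<bar> \<le> B" if "h \<in> Linf" for h :: "real^'n \<Rightarrow> real"
  proof -
    obtain B where "AE x in lebesgue. \<bar>h x\<bar> \<le> B" using \<open>h \<in> Linf\<close> unfolding Linf_def by blast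
    then have "AE x in lebesgue. x \<in> \<Omega> \<longrightarrow> \<bar>h x\<bar> \<le> max 0 B" by eventually_elim auto
    then have "AE x in lebesgue_on \<Omega>. \<bar>h x\<bar> \<le> max 0 B" by (simp add: AE_restrict_space_iff)
    then show ?thesis by (intro exI[of _ "max 0 B"]) simp
  qed
  obtain B where B: "B \<ge> 0" "AE x in lebesgue_on \<Omega>. \<bar>f x\<bar> \<le> B" using bdd assms(1) by blast
  obtain E where E: "E \<ge> 0" "AE x in lebesgue_on \<Omega>. \<bar>g x\<bar> \<le> E" using bdd assms(2) by blast
  define D where "D = B\<^sup>2 / \<delta> + E\<^sup>2"
  have fm: "f \<in> borel_measurable (lebesgue_on \<Omega>)" and gm: "g \<in> borel_measurable (lebesgue_on \<Omega>)"
    using assms(1,2) by (simp_all add: Linf_def measurable_restrict_space1)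
  show thesis
  proof (rule that)
    show "0 \<le> D * measure (lebesgue_on \<Omega>) \<Omega>" using \<delta> by (simp add: D_def)
    fix u assume "u \<in> H1 \<Omega>"
    note U = H1D[OF \<Omega> this]
    have um: "u \<in> borel_measurable (lebesgue_on \<Omega>)" and ui: "integrable (lebesgue_on \<Omega>) (\<lambda>x. (norm (u x))\<^sup>2)"
      using U(1) by (auto simp: L2_def)
    have gi: "integrable (lebesgue_on \<Omega>) (\<lambda>x. (norm (weak_grad \<Omega> u x))\<^sup>2)"
      using U(3) by (simp add: L2_def)
    define R where "R x = - 2 * f x * u x + (g x)\<^sup>2 * indicator {y. 0 < u y} x" for x
    have Rm: "R \<in> borel_measurable (lebesgue_on \<Omega>)"
    proof -
      have "(\<lambda>x. indicator {0<..} (u x) :: real) \<in> borel_measurable (lebesgue_on \<Omega>)"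
        using um by measurable
      then have "(\<lambda>x. indicator {y. 0 < u y} x :: real) \<in> borel_measurable (lebesgue_on \<Omega>)"
        by (simp add: indicator_def)
      then show ?thesis unfolding R_def using fm gm um by measurable
    qed
    have Rb: "AE x in lebesgue_on \<Omega>. norm (R x) \<le> \<delta> * (norm (u x))\<^sup>2 + D"
      using B(2) E(2)
    proof eventually_elim
      case (elim x)
      have "0 \<le> (sqrt \<delta> * \<bar>u x\<bar> - \<bar>f x\<bar> / sqrt \<delta>)\<^sup>2" by simp
      then have "\<bar>2 * f x * u x\<bar> \<le> \<delta> * (norm (u x))\<^sup>2 + (f x)\<^sup>2 / \<delta>"
        using \<delta> by (simp add: power2_diff power_mult_distrib power_divide abs_mult mult_ac)
      moreover have "(f x)\<^sup>2 / \<delta> \<le> B\<^sup>2 / \<delta>"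
        using elim(1) \<delta> by (intro divide_right_mono) (auto simp: abs_le_square_iff[symmetric] B(1))
      moreover have "\<bar>(g x)\<^sup>2 * indicator {y. 0 < u y} x\<bar> \<le> E\<^sup>2"
        using elim(2) E(1) by (auto simp: indicator_def abs_le_square_iff[symmetric])
      ultimately show ?case unfolding R_def D_def real_norm_def by linarith
    qed
    have bi: "integrable (lebesgue_on \<Omega>) (\<lambda>x. \<delta> * (norm (u x))\<^sup>2 + D)"
      using ui by simp
    have Ri: "integrable (lebesgue_on \<Omega>) R"
      by (rule Bochner_Integration.integrable_bound[OF bi Rm]) (use Rb in \<open>auto elim!: eventually_mono\<close>)
    have "J_fun f g lam \<Omega> u = (\<integral>x. ((norm (weak_grad \<Omega> u x))\<^sup>2 - lam * (norm (u x))\<^sup>2) + R x \<partial>lebesgue_on \<Omega>)"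
      unfolding J_fun_def by (intro Bochner_Integration.integral_cong refl) (simp add: R_def)
    also have "\<dots> = ((L2_norm \<Omega> (weak_grad \<Omega> u))\<^sup>2 - lam * (L2_norm \<Omega> u)\<^sup>2) + (\<integral>x. R x \<partial>lebesgue_on \<Omega>)"
      using ui gi Ri by (simp add: L2_norm_sq)
    finally have J: "J_fun f g lam \<Omega> u - ((L2_norm \<Omega> (weak_grad \<Omega> u))\<^sup>2 - lam * (L2_norm \<Omega> u)\<^sup>2) = (\<integral>x. R x \<partial>lebesgue_on \<Omega>)"
      by simp
    have "\<bar>\<integral>x. R x \<partial>lebesgue_on \<Omega>\<bar> \<le> (\<integral>x. norm (R x) \<partial>lebesgue_on \<Omega>)"
      using integral_norm_bound[of "lebesgue_on \<Omega>" R] by simp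
    also have "\<dots> \<le> (\<integral>x. \<delta> * (norm (u x))\<^sup>2 + D \<partial>lebesgue_on \<Omega>)"
      by (rule integral_mono_AE[OF integrable_norm[OF Ri] bi Rb])
    also have "\<dots> = \<delta> * (L2_norm \<Omega> u)\<^sup>2 + D * measure (lebesgue_on \<Omega>) \<Omega>"
      using ui by (simp add: L2_norm_sq)
    finally show "\<bar>J_fun f g lam \<Omega> u - ((L2_norm \<Omega> (weak_grad \<Omega> u))\<^sup>2 - lam * (L2_norm \<Omega> u)\<^sup>2)\<bar>
      \<le> \<delta> * (L2_norm \<Omega> u)\<^sup>2 + D * measure (lebesgue_on \<Omega>) \<Omega>"
      unfolding J .
  qed
qed

definition smooth_abs :: "real \<Rightarrow> real \<Rightarrow> real" where
  "smooth_abs e y = sqrt (y\<^sup>2 + e\<^sup>2) - e"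

text \<open>The second bound squares \<open>\<bar>y\<bar> - e \<le> smooth_abs e y\<close>; its error is linear in \<open>\<bar>y\<bar>\<close>,
  hence proportional to \<open>e\<close> after integration.\<close>

lemma smooth_abs_bounds:
  assumes "e > 0"
  shows "0 \<le> smooth_abs e y" "y\<^sup>2 - 2 * e * \<bar>y\<bar> \<le> (smooth_abs e y)\<^sup>2"
proof -
  have "e \<le> sqrt (y\<^sup>2 + e\<^sup>2)" using assms by (intro real_le_rsqrt) simp
  then show nn: "0 \<le> smooth_abs e y" by (simp add: smooth_abs_def)
  have ge: "\<bar>y\<bar> \<le> sqrt (y\<^sup>2 + e\<^sup>2)" by (intro real_le_rsqrt) simp
  show "y\<^sup>2 - 2 * e * \<bar>y\<bar> \<le> (smooth_abs e y)\<^sup>2"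
  proof (cases "\<bar>y\<bar> \<le> e")
    case True
    then have "\<bar>y\<bar> * \<bar>y\<bar> \<le> e * \<bar>y\<bar>" by (intro mult_right_mono) auto
    moreover have "0 \<le> e * \<bar>y\<bar>" using assms by simp
    ultimately have "y\<^sup>2 - 2 * e * \<bar>y\<bar> \<le> 0" by (simp add: power2_eq_square)
    then show ?thesis by (rule order_trans) simp
  next
    case False
    then have "(\<bar>y\<bar> - e)\<^sup>2 \<le> (smooth_abs e y)\<^sup>2"
      using ge by (intro power_mono) (auto simp: smooth_abs_def)
    moreover have "(\<bar>y\<bar> - e)\<^sup>2 = y\<^sup>2 - 2 * e * \<bar>y\<bar> + e\<^sup>2"
      by (simp add: power2_diff algebra_simps)
    ultimately show ?thesis by (smt (verit) zero_le_power2)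
  qed
qed

text \<open>The derivative of \<open>sqrt (y\<^sup>2 + e\<^sup>2)\<close> is \<open>y / sqrt (y\<^sup>2 + e\<^sup>2)\<close>, at most \<open>1\<close> in absolute value, so the
  gradient does not grow. Subtracting \<open>e\<close> makes the function vanish where \<open>\<phi>\<close> does, so its support stays in
  that of \<open>\<phi>\<close>.\<close>

lemma scaled_smooth_abs_test_fun:
  fixes \<phi> :: "real^'n::finite \<Rightarrow> real" and t :: real
  assumes \<phi>: "\<phi> \<in> test_fun \<Omega>" and e: "e > 0"
  defines "v \<equiv> \<lambda>x. t * smooth_abs e (\<phi> x)"
  shows "v \<in> test_fun \<Omega>" "norm (grad v x) \<le> \<bar>t\<bar> * norm (grad \<phi> x)"
proof -
  define h where "h = (\<lambda>y. poly [:t:] y * (y\<^sup>2 + e\<^sup>2) powr (1 / 2) + (- t * e))"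
  have v: "v = (\<lambda>x. h (\<phi> x))"
    by (simp add: v_def h_def smooth_abs_def powr_half_sqrt algebra_simps)
  have "h \<in> {h. \<exists>p a c. h = (\<lambda>y. poly p y * (y\<^sup>2 + e\<^sup>2) powr a + c)}"
    unfolding h_def by blast
  then have C: "C_diff k v" for k
    unfolding v by (rule C_diff_compose[OF smooth_family_poly_powr[OF e] _ test_funD(1)[OF \<phi>]])
  have "v x = 0" if "\<phi> x = 0" for x
    using that e by (simp add: v_def smooth_abs_def)
  then have "closure {x. v x \<noteq> 0} \<subseteq> closure {x. \<phi> x \<noteq> 0}"
    by (intro closure_mono) auto
  moreover from this have "compact (closure {x. v x \<noteq> 0})"
    using compact_Int_closed[OF test_funD(5)[OF \<phi>] closed_closure, of "{x. v x \<noteq> 0}"]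
    by (simp add: Int_absorb1)
  ultimately show "v \<in> test_fun \<Omega>"
    using C test_funD(6)[OF \<phi>] by (auto simp: test_fun_def)
  let ?r = "sqrt ((\<phi> x)\<^sup>2 + e\<^sup>2)"
  have pos: "(\<phi> x)\<^sup>2 + e\<^sup>2 > 0" using e by (simp add: add_nonneg_pos)
  have "((\<lambda>y. t * smooth_abs e y) has_real_derivative t * (\<phi> x / ?r)) (at (\<phi> x))"
    unfolding smooth_abs_def using pos
    by (auto intro!: derivative_eq_intros simp: field_simps)
  then have "partial_deriv i v x = t * (\<phi> x / ?r) * partial_deriv i \<phi> x" for i
    unfolding v_def by (rule partial_deriv_compose(2)[OF _ test_funD(2)[OF \<phi>]])
  then have g: "grad v x = (t * (\<phi> x / ?r)) *\<^sub>R grad \<phi> x"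
    by (simp add: grad_def vec_eq_iff)
  have "\<bar>\<phi> x\<bar> \<le> ?r" by (intro real_le_rsqrt) simp
  moreover have "?r > 0" using pos by simp
  ultimately have "\<bar>\<phi> x / ?r\<bar> \<le> 1" by (simp only: abs_divide abs_of_pos divide_le_eq_1_pos)
  then have "\<bar>t * (\<phi> x / ?r)\<bar> \<le> \<bar>t\<bar>"
    unfolding abs_mult by (intro mult_right_le_one_le) auto
  then show "norm (grad v x) \<le> \<bar>t\<bar> * norm (grad \<phi> x)"
    unfolding g norm_scaleR by (intro mult_right_mono) auto
qed

text \<open>With \<open>d = \<Lambda> - \<lambda> > 0\<close>, half of \<open>d\<close> absorbs the lower-order terms. The other half leaves room for
  \<open>c\<close> times the Sobolev norm as soon as \<open>c \<le> 1\<close> and \<open>c (\<Lambda> + 1) \<le> d / 2\<close>, whatever the sign of \<open>\<Lambda>\<close>.\<close>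

lemma coercive_below_fundamental_tone:
  fixes f g :: "real^'n::finite \<Rightarrow> real"
  assumes "f \<in> Linf" "g \<in> Linf" and \<Omega>: "open \<Omega>" and fin: "emeasure lebesgue \<Omega> < \<infinity>"
    and lam: "ereal lam < fundamental_tone \<Omega>"
  shows "coercive_on_H10 \<Omega> (J_fun f g lam \<Omega>)"
proof -
  obtain \<Lambda> where \<Lambda>: "lam < \<Lambda>" "ereal \<Lambda> < fundamental_tone \<Omega>"
    using ereal_dense2[OF lam] by auto
  define d where "d = \<Lambda> - lam"
  define c where "c = min 1 (d / (2 * (\<bar>\<Lambda>\<bar> + 1)))"
  have d: "d > 0" using \<Lambda> by (simp add: d_def)
  have c: "0 < c" "c \<le> 1" using d by (auto simp: c_def)
  have "c * (\<bar>\<Lambda>\<bar> + 1) \<le> d / (2 * (\<bar>\<Lambda>\<bar> + 1)) * (\<bar>\<Lambda>\<bar> + 1)"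
    by (intro mult_right_mono) (auto simp: c_def)
  also have "\<dots> = d / 2" by (simp add: field_simps)
  finally have "c * (\<bar>\<Lambda>\<bar> + 1) \<le> d / 2" .
  moreover have "c * (\<Lambda> + 1) \<le> c * (\<bar>\<Lambda>\<bar> + 1)" using c by (intro mult_left_mono) auto
  ultimately have cd: "c * \<Lambda> + c \<le> d / 2" by (simp add: algebra_simps)
  have "d / 2 > 0" using d by simp
  from J_fun_estimate[OF assms(1-2) \<Omega> fin this, of lam] obtain C where C: "0 \<le> C" "\<And>u. u \<in> H1 \<Omega> \<Longrightarrow>
    \<bar>J_fun f g lam \<Omega> u - ((L2_norm \<Omega> (weak_grad \<Omega> u))\<^sup>2 - lam * (L2_norm \<Omega> u)\<^sup>2)\<bar>
      \<le> d / 2 * (L2_norm \<Omega> u)\<^sup>2 + C" by blast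
  have "c * (H1_norm \<Omega> u)\<^sup>2 - C \<le> J_fun f g lam \<Omega> u" if u: "u \<in> H10 \<Omega>" for u
  proof -
    define A where "A = (L2_norm \<Omega> (weak_grad \<Omega> u))\<^sup>2"
    define b where "b = (L2_norm \<Omega> u)\<^sup>2"
    have "\<Lambda> * b \<le> A"
      unfolding A_def b_def
      by (rule gradient_lower_bound_H10[OF \<Omega> u fundamental_tone_lower_bound]) (use \<Lambda> in simp_all)
    then have "(1 - c) * (\<Lambda> * b) \<le> (1 - c) * A" using c by (intro mult_left_mono) auto
    moreover have "(c * \<Lambda> + c) * b \<le> d / 2 * b" using cd by (intro mult_right_mono) (auto simp: b_def)
    moreover have "A - lam * b - d / 2 * b - C \<le> J_fun f g lam \<Omega> u"
      using C(2)[of u] u by (auto simp: H10_def A_def b_def abs_le_iff)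
    ultimately have "c * (b + A) - C \<le> J_fun f g lam \<Omega> u"
      by (simp add: d_def field_simps)
    then show ?thesis by (simp add: H1_norm_sq A_def b_def)
  qed
  then show ?thesis unfolding coercive_on_H10_def using c C(1) by blast
qed

text \<open>The deficit \<open>\<kappa> = \<lambda> \<parallel>\<phi>\<parallel>\<^sup>2 - \<parallel>\<nabla>\<phi>\<parallel>\<^sup>2 > 0\<close> is spent in quarters: one on the lower-order terms through
  \<open>\<delta>\<close>, one on the smoothing error through \<open>e\<close>. The remaining half, multiplied by \<open>t\<^sup>2\<close>, exceeds every bound.\<close>

lemma unbounded_above_fundamental_tone:
  fixes f g :: "real^'n::finite \<Rightarrow> real"
  assumes "f \<in> Linf" "g \<in> Linf" and \<Omega>: "open \<Omega>" and fin: "emeasure lebesgue \<Omega> < \<infinity>"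
    and lam: "fundamental_tone \<Omega> < ereal lam"
  shows "unbounded_below_on (K_cone \<Omega>) (J_fun f g lam \<Omega>)"
  unfolding unbounded_below_on_def
proof
  fix M :: real
  obtain \<phi> z where \<phi>: "\<phi> \<in> test_fun \<Omega>" "\<phi> z \<noteq> 0"
    and "ereal ((L2_norm \<Omega> (grad \<phi>))\<^sup>2 / (L2_norm \<Omega> \<phi>)\<^sup>2) < ereal lam"
    using lam unfolding fundamental_tone_def INF_less_iff by blast
  define a where "a = (L2_norm \<Omega> (grad \<phi>))\<^sup>2"
  define b where "b = (L2_norm \<Omega> \<phi>)\<^sup>2"
  have b: "b > 0" unfolding b_def by (rule L2_norm_test_fun_pos[OF \<Omega> \<phi>])
  have quot: "a / b < lam"
    using \<open>ereal _ < ereal lam\<close> by (simp add: a_def b_def)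
  then have ab: "a < lam * b" using b by (simp add: divide_less_eq)
  have a: "a \<ge> 0" by (simp add: a_def)
  have lam0: "lam > 0" using quot a b by (smt (verit) divide_nonneg_pos)
  define \<kappa> where "\<kappa> = lam * b - a"
  have \<kappa>: "\<kappa> > 0" using ab by (simp add: \<kappa>_def)
  define I where "I = (\<integral>x. \<bar>\<phi> x\<bar> \<partial>lebesgue_on \<Omega>)"
  have I: "I \<ge> 0" by (simp add: I_def)
  define \<delta> where "\<delta> = \<kappa> / (4 * b)"
  \<comment> \<open>\<open>I + 1\<close> instead of \<open>I\<close> only avoids a case distinction on \<open>I = 0\<close>\<close>
  define e where "e = \<kappa> / (8 * lam * (I + 1))"
  have \<delta>: "\<delta> > 0" "\<delta> * b = \<kappa> / 4" using \<kappa> b by (simp_all add: \<delta>_def)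
  have e: "e > 0" using \<kappa> lam0 I by (simp add: e_def)
  have "lam * (2 * e * I) \<le> lam * (2 * e * (I + 1))"
    using lam0 e by (intro mult_left_mono) auto
  also have "\<dots> = lam * 2 * (e * (I + 1))" by simp
  also have "e * (I + 1) = \<kappa> / (8 * lam)" using I by (simp add: e_def)
  also have "lam * 2 * (\<kappa> / (8 * lam)) = \<kappa> / 4" using lam0 by simp
  finally have eI: "lam * (2 * e * I) \<le> \<kappa> / 4" .
  have \<delta>lam: "\<delta> \<le> lam"
  proof -
    have "\<delta> * b \<le> lam * b" using \<delta>(2) a \<kappa> by (simp add: \<kappa>_def)
    then show ?thesis using b by simp
  qed
  obtain K where K: "compact K" "K \<subseteq> \<Omega>" "\<And>x. x \<notin> K \<Longrightarrow> \<phi> x = 0"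
    using test_fun_support[OF \<phi>(1)] by metis
  have iabs: "integrable (lebesgue_on \<Omega>) (\<lambda>x. \<bar>\<phi> x\<bar>)"
    using integrable_L1_loc_mult[OF \<Omega> continuous_imp_L1_loc[OF continuous_on_const[of _ 1]]
        K(1,2) test_funD(3)[OF \<phi>(1)] K(3)] by (simp add: integrable_abs)
  obtain C where C: "0 \<le> C" "\<And>u. u \<in> H1 \<Omega> \<Longrightarrow>
    \<bar>J_fun f g lam \<Omega> u - ((L2_norm \<Omega> (weak_grad \<Omega> u))\<^sup>2 - lam * (L2_norm \<Omega> u)\<^sup>2)\<bar>
      \<le> \<delta> * (L2_norm \<Omega> u)\<^sup>2 + C"
    using J_fun_estimate[OF assms(1-2) \<Omega> fin \<delta>(1), of lam] by blast
  define t where "t = sqrt (2 * (C + \<bar>M\<bar> + 1) / \<kappa>)"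
  have t: "t\<^sup>2 * (\<kappa> / 2) = C + \<bar>M\<bar> + 1" "t \<ge> 0"
    using C(1) \<kappa> by (simp_all add: t_def)
  define v where "v = (\<lambda>x. t * smooth_abs e (\<phi> x))"
  have v: "v \<in> test_fun \<Omega>" and gv: "norm (grad v x) \<le> t * norm (grad \<phi> x)" for x
    using scaled_smooth_abs_test_fun[OF \<phi>(1) e, of t] t(2) by (simp_all add: v_def)
  have sq: "integrable (lebesgue_on \<Omega>) (\<lambda>x. (norm (\<phi> x))\<^sup>2)" "integrable (lebesgue_on \<Omega>) (\<lambda>x. (norm (grad \<phi> x))\<^sup>2)"
    "integrable (lebesgue_on \<Omega>) (\<lambda>x. (norm (v x))\<^sup>2)" "integrable (lebesgue_on \<Omega>) (\<lambda>x. (norm (grad v x))\<^sup>2)"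
    using test_fun_L2[OF \<Omega> \<phi>(1)] test_fun_L2[OF \<Omega> v] by (simp_all add: L2_def)
  have vH: "v \<in> H10 \<Omega>" by (rule test_fun_in_H10[OF \<Omega> v])
  have vK: "v \<in> K_cone \<Omega>"
    using vH smooth_abs_bounds(1)[OF e] t(2) by (simp add: K_cone_def v_def)
  have W: "L2_norm \<Omega> (weak_grad \<Omega> v) = L2_norm \<Omega> (grad v)"
    by (rule weak_grad_eq(2)[OF \<Omega> has_weak_grad_test_fun[OF \<Omega> v] test_fun_L2(2)[OF \<Omega> v]])
  have "(\<integral>x. (norm (grad v x))\<^sup>2 \<partial>lebesgue_on \<Omega>) \<le> (\<integral>x. t\<^sup>2 * (norm (grad \<phi> x))\<^sup>2 \<partial>lebesgue_on \<Omega>)"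
    using sq power_mono[OF gv, of _ 2] by (intro integral_mono) (auto simp: power_mult_distrib)
  then have A: "(L2_norm \<Omega> (weak_grad \<Omega> v))\<^sup>2 \<le> t\<^sup>2 * a"
    unfolding W a_def L2_norm_sq by simp
  have "(\<integral>x. t\<^sup>2 * ((norm (\<phi> x))\<^sup>2 - 2 * e * \<bar>\<phi> x\<bar>) \<partial>lebesgue_on \<Omega>) \<le> (\<integral>x. (norm (v x))\<^sup>2 \<partial>lebesgue_on \<Omega>)"
  proof (rule integral_mono)
    show "integrable (lebesgue_on \<Omega>) (\<lambda>x. t\<^sup>2 * ((norm (\<phi> x))\<^sup>2 - 2 * e * \<bar>\<phi> x\<bar>))"
      using sq(1) iabs by simp
    show "t\<^sup>2 * ((norm (\<phi> x))\<^sup>2 - 2 * e * \<bar>\<phi> x\<bar>) \<le> (norm (v x))\<^sup>2" for x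
      using smooth_abs_bounds(2)[OF e, of "\<phi> x"]
      by (auto simp: v_def power_mult_distrib intro!: mult_left_mono)
  qed (rule sq)
  also have "(\<integral>x. t\<^sup>2 * ((norm (\<phi> x))\<^sup>2 - 2 * e * \<bar>\<phi> x\<bar>) \<partial>lebesgue_on \<Omega>) = t\<^sup>2 * (b - 2 * e * I)"
    using sq(1) iabs by (simp add: b_def I_def L2_norm_sq)
  finally have V: "t\<^sup>2 * (b - 2 * e * I) \<le> (L2_norm \<Omega> v)\<^sup>2" by (simp add: L2_norm_sq)
  have "J_fun f g lam \<Omega> v \<le> (L2_norm \<Omega> (weak_grad \<Omega> v))\<^sup>2 - (lam - \<delta>) * (L2_norm \<Omega> v)\<^sup>2 + C"
    using C(2)[of v] vH by (auto simp: H10_def abs_le_iff algebra_simps)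
  also have "\<dots> \<le> t\<^sup>2 * a - (lam - \<delta>) * (t\<^sup>2 * (b - 2 * e * I)) + C"
    using A V \<delta>lam by (intro add_right_mono diff_mono mult_left_mono) auto
  also have "\<dots> = t\<^sup>2 * (a - lam * b + \<delta> * b + lam * (2 * e * I) - \<delta> * (2 * e * I)) + C"
    by (simp add: algebra_simps)
  also have "\<dots> \<le> t\<^sup>2 * (- (\<kappa> / 2)) + C"
  proof (intro add_right_mono mult_left_mono)
    have "0 \<le> \<delta> * (2 * e * I)" using \<delta> e I by simp
    then show "a - lam * b + \<delta> * b + lam * (2 * e * I) - \<delta> * (2 * e * I) \<le> - (\<kappa> / 2)"
      using \<delta>(2) eI \<kappa>_def by linarith
  qed simp
  also have "\<dots> = - (C + \<bar>M\<bar> + 1) + C" unfolding t(1)[symmetric] by simp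
  also have "\<dots> < M" by linarith
  finally show "\<exists>u\<in>K_cone \<Omega>. J_fun f g lam \<Omega> u < M" using vK by blast
qed

theorem lemma3p1:
  fixes f g :: "real^'n::finite \<Rightarrow> real" and \<Omega> :: "(real^'n) set" and lam :: real
  assumes "CARD('n) \<ge> 2"
    and "f \<in> Linf" and "g \<in> Linf" and "AE x in lebesgue. 0 \<le> g x"
    and "open \<Omega>" and "emeasure lebesgue \<Omega> < \<infinity>"
  shows "(ereal lam < fundamental_tone \<Omega> \<longrightarrow> coercive_on_H10 \<Omega> (J_fun f g lam \<Omega>)) \<and>
         (fundamental_tone \<Omega> < ereal lam \<longrightarrow> unbounded_below_on (K_cone \<Omega>) (J_fun f g lam \<Omega>))"
  using coercive_below_fundamental_tone[OF assms(2,3,5,6)] unbounded_above_fundamental_tone[OF assms(2,3,5,6)]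
  by blast

end
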